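(* Let $k$ be either a field of characteristic zero or an algebraically closed field of positive characteristic $\neq 2,3$. Let $\mathfrak{g}=\mathfrak{sl}(2,k)\oplus\mathfrak{g}_1$ be a finite-dimensional Lie superalgebra over $k$ with even part $\mathfrak{g}_0=\mathfrak{sl}(2,k)$, odd part $\mathfrak{g}_1$ and bracket $\{\ ,\ \}$, and let $$\mathcal{Z}(\mathfrak{g}):=\{x\in\mathfrak{g}\mid\{x,y\}=0\ \ \forall y\in\mathfrak{g}\}.$$ Then one of the following three cases holds: (a) $\{\mathfrak{g}_1,\mathfrak{g}_1\}=\{0\}$; (b) $\mathfrak{g}_1=(\mathfrak{sl}(2,k)\oplus k)\oplus\mathcal{Z}(\mathfrak{g})$, in the following sense: as a representation of $\mathfrak{sl}(2,k)$, $\mathfrak{g}_1$ can be identified with the direct sum of the adjoint representation $\mathfrak{sl}(2,k)$, a one-dimensional trivial representation $k$, and $\mathcal{Z}(\mathfrak{g})$, in such a way that the only non-trivial brackets on $\mathfrak{g}_1$ are given by $\{v,\lambda\}=\{\lambda,v\}=\lambda v$ for $v\in\mathfrak{sl}(2,k)\subset\mathfrak{g}_1$ and $\lambda\in k\subset\mathfrak{g}_1$, where the right-hand side is understood as an element of the even part $\mathfrak{sl}(2,k)$; (c) $\mathfrak{g}\cong\mathfrak{osp}_k(1|2)\oplus\mathcal{Z}(\mathfrak{g})$ as Lie superalgebras.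
   Context: A Lie superalgebra over $k$ is a $\mathbb{Z}_2$-graded vector space $\mathfrak{g}=\mathfrak{g}_0\oplus\mathfrak{g}_1$ with a bilinear bracket $\{\ ,\ \}$ such that $\{\mathfrak{g}_\alpha,\mathfrak{g}_\beta\}\subseteq\mathfrak{g}_{\alpha+\beta}$, $\{x,y\}=-(-1)^{|x||y|}\{y,x\}$, and $(-1)^{|x||z|}\{x,\{y,z\}\}+(-1)^{|y||x|}\{y,\{z,x\}\}+(-1)^{|z||y|}\{z,\{x,y\}\}=0$ for all homogeneous $x,y,z$ (where $|x|$ is the parity of $x$). In particular $\mathfrak{g}_0$ is a Lie algebra and $\mathfrak{g}_1$ is a representation of $\mathfrak{g}_0$ via $x(v)=\{x,v\}$. $\mathfrak{osp}_k(1|2)$ denotes the Lie superalgebra with even part $\mathfrak{sl}(2,k)$, odd part the standard representation $k^2$ of $\mathfrak{sl}(2,k)$, and bracket on the odd part given by $$\{(a,b),(c,d)\}=\begin{pmatrix}-(ad+bc)&2ac\\-2bd&ad+bc\end{pmatrix}.$$ *)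

theory Defs
  imports "HOL-Analysis.Analysis" "HOL-Library.Z2" "HOL-Computational_Algebra.Polynomial"
begin

section \<open>Lie superalgebras\<close>

text \<open>
  The degrees are the elements of the two-element field \<^typ>\<open>bit\<close>, so that \<open>part L 0\<close> is the even
  and \<open>part L 1\<close> the odd part. The underlying space of \<open>L\<close> is the subset \<open>carr L\<close> of the
  type \<open>'g\<close>, which lets subspaces (for example the centre) be superalgebras themselves;
  nothing is said about \<open>bracket L\<close> outside \<open>carr L\<close>.
\<close>

record ('k, 'g) superalgebra =
  smul :: "'k \<Rightarrow> 'g \<Rightarrow> 'g"
  part :: "bit \<Rightarrow> 'g set"
  bracket :: "'g \<Rightarrow> 'g \<Rightarrow> 'g"

definition carr :: "('k, 'g::ab_group_add) superalgebra \<Rightarrow> 'g set" where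
  "carr L = {x + y | x y. x \<in> part L 0 \<and> y \<in> part L 1}"

definition koszul :: "bit \<Rightarrow> bit \<Rightarrow> 'k::field" where
  "koszul \<alpha> \<beta> = (- 1) ^ of_bit (\<alpha> * \<beta>)"

locale lie_superalgebra = vector_space "smul L"
  for L :: "('k::field, 'g::ab_group_add) superalgebra" +
  assumes subspace_part: "subspace (part L \<alpha>)"
    and parts_independent: "part L 0 \<inter> part L 1 = {0}"
    and bracket_add_left:
      "\<lbrakk>x \<in> carr L; y \<in> carr L; z \<in> carr L\<rbrakk> \<Longrightarrow> bracket L (x + y) z = bracket L x z + bracket L y z"
    and bracket_add_right:
      "\<lbrakk>x \<in> carr L; y \<in> carr L; z \<in> carr L\<rbrakk> \<Longrightarrow> bracket L x (y + z) = bracket L x y + bracket L x z"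
    and bracket_smult_left:
      "\<lbrakk>x \<in> carr L; y \<in> carr L\<rbrakk> \<Longrightarrow> bracket L (smul L c x) y = smul L c (bracket L x y)"
    and bracket_smult_right:
      "\<lbrakk>x \<in> carr L; y \<in> carr L\<rbrakk> \<Longrightarrow> bracket L x (smul L c y) = smul L c (bracket L x y)"
    and bracket_graded:
      "\<lbrakk>x \<in> part L \<alpha>; y \<in> part L \<beta>\<rbrakk> \<Longrightarrow> bracket L x y \<in> part L (\<alpha> + \<beta>)"
    and super_antisym:
      "\<lbrakk>x \<in> part L \<alpha>; y \<in> part L \<beta>\<rbrakk> \<Longrightarrow>
        bracket L x y = - smul L (koszul \<alpha> \<beta>) (bracket L y x)"
    and super_jacobi:
      "\<lbrakk>x \<in> part L \<alpha>; y \<in> part L \<beta>; z \<in> part L \<gamma>\<rbrakk> \<Longrightarrow>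
        smul L (koszul \<alpha> \<gamma>) (bracket L x (bracket L y z))
        + smul L (koszul \<beta> \<alpha>) (bracket L y (bracket L z x))
        + smul L (koszul \<gamma> \<beta>) (bracket L z (bracket L x y)) = 0"

definition finite_dim :: "('k::field, 'g::ab_group_add) superalgebra \<Rightarrow> bool" where
  "finite_dim L \<longleftrightarrow> (\<exists>B. finite B \<and> module.span (smul L) B = carr L)"

definition center :: "('k, 'g::ab_group_add) superalgebra \<Rightarrow> 'g set" where
  "center L = {x \<in> carr L. \<forall>y \<in> carr L. bracket L x y = 0}"

text \<open>
  The graded subspace of \<open>L\<close> with homogeneous parts \<open>part L \<alpha> \<inter> S\<close>. For \<open>S = center L\<close> and for
  \<open>S = part L 0\<close> its underlying space is \<open>S\<close>.
\<close>

definition sub_superalgebra ::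
  "('k, 'g) superalgebra \<Rightarrow> 'g set \<Rightarrow> ('k, 'g) superalgebra" where
  "sub_superalgebra L S = L\<lparr>part := \<lambda>\<alpha>. part L \<alpha> \<inter> S\<rparr>"

definition direct_sum ::
  "('k, 'g) superalgebra \<Rightarrow> ('k, 'h) superalgebra \<Rightarrow> ('k, 'g \<times> 'h) superalgebra" where
  "direct_sum L M =
    \<lparr>smul = \<lambda>c (x, y). (smul L c x, smul M c y),
     part = \<lambda>\<alpha>. part L \<alpha> \<times> part M \<alpha>,
     bracket = \<lambda>(x, y) (x', y'). (bracket L x x', bracket M y y')\<rparr>"

definition superalgebra_iso ::
  "('g \<Rightarrow> 'h) \<Rightarrow> ('k, 'g::ab_group_add) superalgebra \<Rightarrow> ('k, 'h::ab_group_add) superalgebra \<Rightarrow> bool"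
  where
  "superalgebra_iso f L M \<longleftrightarrow>
     bij_betw f (carr L) (carr M) \<and>
     (\<forall>\<alpha>. f ` part L \<alpha> = part M \<alpha>) \<and>
     (\<forall>x\<in>carr L. \<forall>y\<in>carr L. f (x + y) = f x + f y) \<and>
     (\<forall>c. \<forall>x\<in>carr L. f (smul L c x) = smul M c (f x)) \<and>
     (\<forall>x\<in>carr L. \<forall>y\<in>carr L. f (bracket L x y) = bracket M (f x) (f y))"

definition superalgebra_isomorphic ::
  "('k, 'g::ab_group_add) superalgebra \<Rightarrow> ('k, 'h::ab_group_add) superalgebra \<Rightarrow> bool" where
  "superalgebra_isomorphic L M \<longleftrightarrow> (\<exists>f. superalgebra_iso f L M)"


section \<open>The algebras sl(2) and osp(1|2)\<close>

definition sl2 :: "('k::field ^ 2 ^ 2) set" where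
  "sl2 = {A. trace A = 0}"

definition mat_smult :: "'k::field \<Rightarrow> 'k ^ 2 ^ 2 \<Rightarrow> 'k ^ 2 ^ 2" where
  "mat_smult c A = (\<chi> i. c *s A $ i)"

definition commutator :: "'k::field ^ 2 ^ 2 \<Rightarrow> 'k ^ 2 ^ 2 \<Rightarrow> 'k ^ 2 ^ 2" where
  "commutator A B = A ** B - B ** A"

text \<open>The Lie algebra sl(2), regarded as a Lie superalgebra with odd part 0.\<close>

definition sl2_algebra :: "('k::field, 'k ^ 2 ^ 2) superalgebra" where
  "sl2_algebra =
    \<lparr>smul = mat_smult,
     part = \<lambda>\<alpha>. if \<alpha> = 0 then sl2 else {0},
     bracket = commutator\<rparr>"

definition osp_odd_bracket :: "'k::field ^ 2 \<Rightarrow> 'k ^ 2 \<Rightarrow> 'k ^ 2 ^ 2" where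
  "osp_odd_bracket v w =
    (let a = v $ 1; b = v $ 2; c = w $ 1; d = w $ 2 in
      vector [vector [- (a * d + b * c), 2 * a * c],
              vector [- 2 * b * d, a * d + b * c]])"

definition osp12 :: "('k::field, ('k ^ 2 ^ 2) \<times> ('k ^ 2)) superalgebra" where
  "osp12 =
    \<lparr>smul = \<lambda>c (A, v). (mat_smult c A, c *s v),
     part = \<lambda>\<alpha>. if \<alpha> = 0 then sl2 \<times> {0} else {0} \<times> UNIV,
     bracket = \<lambda>(A, v) (B, w). (commutator A B + osp_odd_bracket v w, A *v w - B *v v)\<rparr>"

text \<open>
  \<open>\<iota>\<close> identifies the even part of \<open>L\<close> with sl(2), as Lie algebras.
\<close>

definition even_part_sl2 ::
  "('k::field ^ 2 ^ 2 \<Rightarrow> 'g::ab_group_add) \<Rightarrow> ('k, 'g) superalgebra \<Rightarrow> bool" where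
  "even_part_sl2 \<iota> L \<longleftrightarrow> superalgebra_iso \<iota> sl2_algebra (sub_superalgebra L (part L 0))"


section \<open>Odd part of the form sl(2) + k + centre\<close>

text \<open>
  \<open>\<Phi>\<close> is an isomorphism of sl(2)-representations from the direct sum of the adjoint
  representation, the trivial representation \<open>k\<close> and the centre onto the odd part, restricting to
  the inclusion on the centre. The last clause is the bilinear extension of
  \<open>{v, r} = {r, v} = r v\<close>, all other brackets between the three summands being 0.
\<close>

definition adjoint_trivial_center_decomposition ::
  "('k::field ^ 2 ^ 2 \<Rightarrow> 'g::ab_group_add) \<Rightarrow> ('k, 'g) superalgebra \<Rightarrow>
    (('k ^ 2 ^ 2) \<times> 'k \<times> 'g \<Rightarrow> 'g) \<Rightarrow> bool" where
  "adjoint_trivial_center_decomposition \<iota> L \<Phi> \<longleftrightarrow>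
    (let D = sl2 \<times> UNIV \<times> center L in
     bij_betw \<Phi> D (part L 1) \<and>
     (\<forall>p\<in>D. \<forall>q\<in>D. \<Phi> (p + q) = \<Phi> p + \<Phi> q) \<and>
     (\<forall>c. \<forall>(v, r, z)\<in>D. \<Phi> (mat_smult c v, c * r, smul L c z) = smul L c (\<Phi> (v, r, z))) \<and>
     (\<forall>z\<in>center L. \<Phi> (0, 0, z) = z) \<and>
     (\<forall>A\<in>sl2. \<forall>(v, r, z)\<in>D.
        bracket L (\<iota> A) (\<Phi> (v, r, z)) = \<Phi> (commutator A v, 0, bracket L (\<iota> A) z)) \<and>
     (\<forall>(v, r, z)\<in>D. \<forall>(w, s, y)\<in>D.
        bracket L (\<Phi> (v, r, z)) (\<Phi> (w, s, y)) = \<iota> (mat_smult s v + mat_smult r w)))"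


section \<open>Algebraically closed fields\<close>

text \<open>
  The predicate form of the class \<^class>\<open>alg_closed_field\<close>, which cannot itself occur
  in one alternative of a disjunctive hypothesis on a type.
\<close>

definition algebraically_closed :: "'k::field itself \<Rightarrow> bool" where
  "algebraically_closed _ \<longleftrightarrow> (\<forall>p :: 'k poly. degree p > 0 \<longrightarrow> (\<exists>x. poly p x = 0))"

end

theory Submission
  imports Defs
begin

text \<open>
  Write \<open>P\<close> for the bracket on the odd part \<open>V\<close>. The Jacobi identity gives \<open>P(x,x) x = 0\<close> and
  \<open>P(x,x) v = -2 P(x,v) x\<close>, so \<open>A = P(x,x)\<close> maps \<open>V\<close> into \<open>sl(2) x\<close>, and this replaces complete
  reducibility.

  If some \<open>A = P(x,x)\<close> has nonzero determinant, then the eigenvalues of \<open>A\<^sup>2\<close> on \<open>V\<close> are \<open>0\<close> and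
  \<open>4 \<delta>\<close> with \<open>\<delta> = - det A\<close>. This forces \<open>x\<close> to be the sum of a generator \<open>z\<close> of a copy of the
  adjoint representation and an invariant vector, and \<open>V\<close> to be the sum of that copy and the
  invariants; \<open>P\<close> vanishes on the copy and on the invariants, which gives case (b).

  If all \<open>P(v,v)\<close> have determinant zero and \<open>A = P(x,x) \<noteq> 0\<close>, then polarising \<open>det P(v,v) = 0\<close> shows
  that \<open>P(x,v)\<close> is orthogonal to \<open>A\<close>, so the nilpotent \<open>A\<close> has rank at most one on \<open>V\<close>. Its image is
  spanned by a highest weight vector of weight one, \<open>V\<close> is the sum of the standard representation
  and the invariants, and the invariants are central; this is case (c).
\<close>

section \<open>Traceless two by two matrices\<close>

lemma mat2_eq_iff:
  fixes A B :: "'a ^ 2 ^ 2"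
  shows "A = B \<longleftrightarrow> A$1$1 = B$1$1 \<and> A$1$2 = B$1$2 \<and> A$2$1 = B$2$1 \<and> A$2$2 = B$2$2"
  by (auto simp: vec_eq_iff forall_2)

lemma matrix_mult_nth2:
  fixes A B :: "'k::field ^ 2 ^ 2"
  shows "(A ** B) $ i $ j = A$i$1 * B$1$j + A$i$2 * B$2$j"
  by (simp add: matrix_matrix_mult_def sum_2)

lemma mat_smult_nth [simp]: "mat_smult c A $ i $ j = c * A $ i $ j"
  by (simp add: mat_smult_def)

lemma trace_mat2: "trace (A :: 'k::field ^ 2 ^ 2) = A$1$1 + A$2$2"
  by (simp add: trace_def sum_2)

lemma mem_sl2_iff: "A \<in> sl2 \<longleftrightarrow> A$2$2 = - A$1$1"
  by (auto simp: sl2_def trace_mat2 add_eq_0_iff)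

lemma commutator_nth:
  "commutator A B $ i $ j = A$i$1 * B$1$j + A$i$2 * B$2$j - (B$i$1 * A$1$j + B$i$2 * A$2$j)"
  by (simp add: commutator_def matrix_mult_nth2)

lemmas mat2_simps = mat2_eq_iff mat_smult_nth commutator_nth

definition mat2 :: "'k::field \<Rightarrow> 'k \<Rightarrow> 'k \<Rightarrow> 'k \<Rightarrow> 'k ^ 2 ^ 2" where
  "mat2 a b c d = vector [vector [a, b], vector [c, d]]"

lemma mat2_nth [simp]:
  "mat2 a b c d $ 1 $ 1 = a" "mat2 a b c d $ 1 $ 2 = b"
  "mat2 a b c d $ 2 $ 1 = c" "mat2 a b c d $ 2 $ 2 = d"
  by (simp_all add: mat2_def vector_2)

lemma sl2_zero [simp]: "0 \<in> sl2"
  and sl2_add [simp]: "A \<in> sl2 \<Longrightarrow> B \<in> sl2 \<Longrightarrow> A + B \<in> sl2"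
  and sl2_mat_smult [simp]: "A \<in> sl2 \<Longrightarrow> mat_smult c A \<in> sl2"
  and sl2_commutator [simp]: "commutator A B \<in> sl2"
  by (auto simp: mem_sl2_iff commutator_nth algebra_simps)

lemma mat_smult_add_right: "mat_smult c (A + B) = mat_smult c A + mat_smult c B"
  and mat_smult_assoc: "mat_smult c (mat_smult d A) = mat_smult (c * d) A"
  and mat_smult_one [simp]: "mat_smult 1 A = A"
  and mat_smult_zero_left [simp]: "mat_smult 0 A = 0"
  and mat_smult_zero_right [simp]: "mat_smult c 0 = 0"
  by (simp_all add: mat2_eq_iff algebra_simps)

lemma commutator_self [simp]: "commutator A A = 0"
  by (simp add: commutator_def)

lemma commutator_add_right: "commutator M (A + B) = commutator M A + commutator M B"
  and commutator_smult_right: "commutator M (mat_smult c A) = mat_smult c (commutator M A)"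
  by (simp_all add: mat2_eq_iff commutator_nth algebra_simps)

lemma mat_double_cancel:
  fixes M N :: "'k::field ^ 2 ^ 2"
  assumes "(2::'k) \<noteq> 0" and "M + M = N + N"
  shows "M = N"
  using assms by (simp add: mat2_eq_iff flip: mult_2)

lemma commutator_zero_right [simp]: "commutator M 0 = 0"
  by (simp add: mat2_eq_iff commutator_nth)

lemma det_sl2: "A \<in> sl2 \<Longrightarrow> det A = - (A$1$1 * A$1$1 + A$1$2 * A$2$1)"
  by (simp add: det_2 mem_sl2_iff)

text \<open>Testing against \<open>mat2 1 0 0 (-1)\<close> kills the off-diagonal entries of M, and
  testing against \<open>mat2 0 1 0 0\<close> kills the diagonal ones; both steps divide by
  2.\<close>

lemma sl2_center:
  fixes M :: "'k::field ^ 2 ^ 2"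
  assumes two: "(2::'k) \<noteq> 0" and M: "M \<in> sl2" and c: "\<And>N. N \<in> sl2 \<Longrightarrow> commutator N M = 0"
  shows "M = 0"
proof -
  have "commutator (mat2 1 0 0 (-1)) M = 0" "commutator (mat2 0 1 0 0) M = 0"
    by (auto intro!: c simp: mem_sl2_iff)
  with M two show ?thesis
    by (auto simp: mat2_simps mem_sl2_iff)
qed

text \<open>
  An orthogonal basis for the trace form; no eigenvalue of \<open>A\<close> needs to lie in the field.
\<close>

lemma orthogonal_triple:
  fixes A :: "'k::field ^ 2 ^ 2"
  assumes two: "(2::'k) \<noteq> 0" and A: "A \<in> sl2" and det: "det A \<noteq> 0"
  obtains B C \<delta> \<beta> where
    "\<delta> \<noteq> 0" "\<beta> \<noteq> 0" "B \<in> sl2" "commutator A B = C" "commutator A C = mat_smult (4 * \<delta>) B"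
    "commutator B C = mat_smult (- 4 * \<beta>) A"
    "\<And>M. M \<in> sl2 \<Longrightarrow> \<exists>a b c. M = mat_smult a A + mat_smult b B + mat_smult c C"
    "\<And>a b c. mat_smult a A + mat_smult b B + mat_smult c C = 0 \<Longrightarrow> a = 0 \<and> b = 0 \<and> c = 0"
proof -
  define a b c where abc: "a = A$1$1" "b = A$1$2" "c = A$2$1"
  define \<delta> where "\<delta> = a * a + b * c"
  have d: "A$2$2 = - a" using A by (simp add: abc mem_sl2_iff)
  have \<delta>: "\<delta> \<noteq> 0" using det d by (simp add: det_2 \<delta>_def abc[symmetric] add_eq_0_iff)
  \<comment> \<open>The candidate B has rows (p, q) and (r, -p). The equation says that the trace of
    A B is zero, and the inequality says that det B is nonzero. When b c = 0 the witnesses make p p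
    + q r equal to 1.\<close>
  have "\<exists>p q r. 2 * a * p + b * r + c * q = 0 \<and> p * p + q * r \<noteq> 0"
  proof (cases "b * c = 0")
    case False
    then show ?thesis by (intro exI[of _ 0] exI[of _ b] exI[of _ "- c"]) simp
  next
    case True
    then have a: "a \<noteq> 0" using \<delta> by (auto simp: \<delta>_def)
    show ?thesis
    proof (cases "b = 0")
      case True
      then show ?thesis
        using a two by (intro exI[of _ "-c"] exI[of _ "2*a"] exI[of _ "(1 - c * c) / (2 * a)"]) simp
    next
      case False
      with \<open>b * c = 0\<close> show ?thesis
        using a two by (intro exI[of _ "-b"] exI[of _ "(1 - b * b) / (2 * a)"] exI[of _ "2*a"]) simp
    qed
  qed
  then obtain p q r where orth: "2 * a * p + b * r + c * q = 0" and pqr: "p * p + q * r \<noteq> 0" by blast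
  define \<beta> where "\<beta> = p * p + q * r"
  define B where "B = mat2 p q r (- p)"
  define C where "C = commutator A B"
  have \<beta>: "\<beta> \<noteq> 0" using pqr by (simp add: \<beta>_def)
  \<comment> \<open>Orthogonality makes A and B anticommute, and their squares are the scalars
    \<delta> and \<beta>. Hence C = 2 A B, which explains the constants 4 \<delta> and -4
    \<beta>.\<close>
  have AC: "commutator A C = mat_smult (4 * \<delta>) B"
    using orth unfolding mat2_simps C_def B_def \<delta>_def mat2_nth abc[symmetric] d by algebra
  have BC: "commutator B C = mat_smult (- 4 * \<beta>) A"
    using orth unfolding mat2_simps C_def B_def \<beta>_def mat2_nth abc[symmetric] d by algebra
  have "(8::'k) = 2 * 2 * 2" by simp
  then have nz: "8 * \<delta> * \<beta> \<noteq> 0" using two \<delta> \<beta> by (metis mult_eq_0_iff)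
  have span: "\<exists>u v w. M = mat_smult u A + mat_smult v B + mat_smult w C" if M: "M \<in> sl2" for M
  proof -
    define m n l where mnl: "m = M$1$1" "n = M$1$2" "l = M$2$1"
    have m: "M$2$2 = - m" using M by (simp add: mnl mem_sl2_iff)
    \<comment> \<open>These are the traces of M A, M B and M C. The traces of A A, B B and C C are 2
      \<delta>, 2 \<beta> and -8 \<delta> \<beta>, which gives the coefficients of M after clearing
      denominators.\<close>
    define u v w where uvw: "u = 2*m*a + n*c + l*b" "v = 2*m*p + n*r + l*q"
      "w = 2*m*(b*r-c*q) + n*2*(c*p-a*r) + l*2*(a*q-b*p)"
    have "mat_smult (8 * \<delta> * \<beta>) M = mat_smult (4 * \<beta> * u) A + mat_smult (4 * \<delta> * v) B + mat_smult (- w) C"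
      using orth unfolding mat2_simps C_def B_def \<delta>_def \<beta>_def uvw mat2_nth
        vector_add_component mnl[symmetric] m abc[symmetric] d by algebra
    then have "M = mat_smult (inverse (8 * \<delta> * \<beta>))
        (mat_smult (4 * \<beta> * u) A + mat_smult (4 * \<delta> * v) B + mat_smult (- w) C)"
      by (metis mat_smult_assoc mat_smult_one left_inverse nz)
    then have "M = mat_smult (inverse (8 * \<delta> * \<beta>) * (4 * \<beta> * u)) A
        + mat_smult (inverse (8 * \<delta> * \<beta>) * (4 * \<delta> * v)) B
        + mat_smult (inverse (8 * \<delta> * \<beta>) * (- w)) C"
      by (simp only: mat_smult_add_right mat_smult_assoc)
    then show ?thesis by blast
  qed
  have indep: "u = 0 \<and> v = 0 \<and> w = 0" if "mat_smult u A + mat_smult v B + mat_smult w C = 0" for u v w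
  proof -
    have "2 * \<delta> * u = 0" "2 * \<beta> * v = 0" "8 * \<delta> * \<beta> * w = 0"
      using that orth unfolding mat2_simps C_def B_def \<delta>_def \<beta>_def mat2_nth
        vector_add_component zero_index abc[symmetric] d by algebra+
    then show ?thesis using two \<delta> \<beta> nz by simp
  qed
  show ?thesis
    by (rule that[of \<delta> \<beta> B C]) (use \<delta> \<beta> AC BC span indep in \<open>auto simp: C_def B_def mem_sl2_iff\<close>)
qed


section \<open>Modules with an equivariant symmetric map to sl(2)\<close>

text \<open>The axioms \<open>act_commutator\<close>, \<open>P_equivariant\<close> and
  \<open>jacobi\<close> are the super Jacobi identity with one, two and three odd arguments.\<close>

locale sl2_odd_module = vector_space scale
  for scale :: "'k::field \<Rightarrow> 'v::ab_group_add \<Rightarrow> 'v" (infixr "\<cdot>" 75) +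
  fixes act :: "'k ^ 2 ^ 2 \<Rightarrow> 'v \<Rightarrow> 'v"
    and P :: "'v \<Rightarrow> 'v \<Rightarrow> 'k ^ 2 ^ 2"
  assumes two: "(2::'k) \<noteq> 0" and three: "(3::'k) \<noteq> 0"
    and act_add_left: "act (M + N) v = act M v + act N v"
    and act_scale_left: "act (mat_smult c M) v = c \<cdot> act M v"
    and act_add_right: "act M (v + w) = act M v + act M w"
    and act_scale_right: "act M (c \<cdot> v) = c \<cdot> act M v"
    and act_commutator: "act (commutator M N) v = act M (act N v) - act N (act M v)"
    and P_sl2: "P v w \<in> sl2"
    and P_sym: "P v w = P w v"
    and P_add_left: "P (u + v) w = P u w + P v w"
    and P_scale_left: "P (c \<cdot> v) w = mat_smult c (P v w)"
    and P_equivariant: "commutator M (P v w) = P (act M v) w + P v (act M w)"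
    and jacobi: "act (P u v) w + act (P v w) u + act (P w u) v = 0"
begin

lemma P_add_right: "P w (u + v) = P w u + P w v"
  and P_scale_right: "P w (c \<cdot> v) = mat_smult c (P w v)"
  by (simp_all only: P_sym[of w] P_add_left P_scale_left)

lemma act_zero_left [simp]: "act 0 v = 0"
  using act_scale_left[of 0 0 v] by simp

lemma act_zero_right [simp]: "act M 0 = 0"
  using act_scale_right[of M 0 0] by simp

lemma act_minus_right: "act M (- v) = - act M v"
  using act_add_right[of M v "- v"] by (simp add: add_eq_0_iff)

lemma act_diff_right: "act M (v - w) = act M v - act M w"
  using act_add_right[of M "v - w" w] by (simp add: algebra_simps)

lemma P_zero_left [simp]: "P 0 w = 0"
  using P_scale_left[of 0 0 w] by simp

lemma P_zero_right [simp]: "P w 0 = 0"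
  by (simp add: P_sym[of w])

lemma P_minus_left: "P (- v) w = - P v w"
  using P_add_left[of v "- v" w] by (simp add: eq_neg_iff_add_eq_0 add.commute)

lemmas act_simps = act_add_left act_scale_left act_add_right act_scale_right act_diff_right
lemmas P_simps = P_add_left P_scale_left P_add_right P_scale_right

lemma numerals_nonzero: "(4::'k) \<noteq> 0" "(6::'k) \<noteq> 0" "(8::'k) \<noteq> 0" "(12::'k) \<noteq> 0"
proof -
  have "(4::'k) = 2 * 2" "(6::'k) = 2 * 3" "(8::'k) = 2 * 2 * 2" "(12::'k) = 2 * 2 * 3"
    by simp_all
  then show "(4::'k) \<noteq> 0" "(6::'k) \<noteq> 0" "(8::'k) \<noteq> 0" "(12::'k) \<noteq> 0"
    using two three by (metis mult_eq_0_iff)+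
qed

lemma scale_two: "2 \<cdot> v = v + v"
  using scale_left_distrib[of 1 1 v] by simp

lemma add_self_eq_0_iff: "(v::'v) + v = 0 \<longleftrightarrow> v = 0"
  using two by (simp add: scale_two[symmetric])

lemma act_square: "act (P x x) v = - 2 \<cdot> act (P x v) x"
  using jacobi[of x x v] by (simp add: P_sym[of v x] scale_two add_eq_0_iff2 add.assoc)

lemma act_square_self: "act (P x x) x = 0"
proof -
  \<comment> \<open>At v = x the identity \<open>act_square\<close> moves to one side as 1 + 2
    copies of the same vector; this is where 3 must be invertible.\<close>
  have "(1 + 2) \<cdot> act (P x x) x = 0"
    using act_square[of x x] by (simp only: scale_left_distrib scale_one add_eq_0_iff2 scale_minus_left)
  then show ?thesis using three by simp
qed

definition invariants :: "'v set" where
  "invariants = {t. \<forall>N\<in>sl2. act N t = 0}"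

text \<open>For the module of a Lie superalgebra, the odd members of this set form the centre; see
  \<open>center_radical\<close>.\<close>

definition radical :: "'v set" where
  "radical = {t \<in> invariants. \<forall>v. P t v = 0}"

text \<open>By equivariance \<open>P s t\<close> commutes with all of sl(2), whose centre is
  trivial.\<close>

lemma P_invariants:
  assumes "s \<in> invariants" "t \<in> invariants"
  shows "P s t = 0"
  by (rule sl2_center[OF two P_sl2]) (use assms in \<open>simp add: P_equivariant invariants_def\<close>)

lemma invariants_add: "s \<in> invariants \<Longrightarrow> t \<in> invariants \<Longrightarrow> s + t \<in> invariants"
  and invariants_scale: "t \<in> invariants \<Longrightarrow> c \<cdot> t \<in> invariants"
  and invariants_diff: "s \<in> invariants \<Longrightarrow> t \<in> invariants \<Longrightarrow> s - t \<in> invariants"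
  by (simp_all add: invariants_def act_simps)

end


section \<open>A square outside the nilpotent cone\<close>

locale semisimple_square = sl2_odd_module scale act P
  for scale :: "'k::field \<Rightarrow> 'v::ab_group_add \<Rightarrow> 'v" (infixr "\<cdot>" 75) and act P +
  fixes x A B C \<delta> \<beta>
  assumes P_xx: "P x x = A"
    and \<delta>: "\<delta> \<noteq> 0" and \<beta>: "\<beta> \<noteq> 0"
    and A_sl2: "A \<in> sl2" and B_sl2: "B \<in> sl2"
    and AB: "commutator A B = C"
    and AC: "commutator A C = mat_smult (4 * \<delta>) B"
    and BC: "commutator B C = mat_smult (- 4 * \<beta>) A"
    and span: "M \<in> sl2 \<Longrightarrow> \<exists>a b c. M = mat_smult a A + mat_smult b B + mat_smult c C"
    and indep: "mat_smult a A + mat_smult b B + mat_smult c C = 0 \<Longrightarrow> a = 0 \<and> b = 0 \<and> c = 0"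
begin

lemma C_sl2: "C \<in> sl2" using AB by auto

lemma act_B_A: "act B (act A v) = act A (act B v) - act C v"
  using act_commutator[of A B v] by (simp add: AB)

lemma act_C_A: "act C (act A v) = act A (act C v) - (4 * \<delta>) \<cdot> act B v"
  using act_commutator[of A C v] by (simp add: AC act_simps)

lemma act_C_B: "act C (act B v) = act B (act C v) + (4 * \<beta>) \<cdot> act A v"
  using act_commutator[of B C v] by (simp add: BC act_simps algebra_simps)

lemma BA: "commutator B A = mat_smult (- 1) C"
  and CA: "commutator C A = mat_smult (- 4 * \<delta>) B"
proof -
  show "commutator B A = mat_smult (- 1) C"
    by (simp add: AB[symmetric] mat2_eq_iff commutator_nth)
  have "commutator C A = mat_smult (- 1) (commutator A C)"
    by (simp add: mat2_eq_iff commutator_nth)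
  then show "commutator C A = mat_smult (- 4 * \<delta>) B"
    by (simp add: AC mat_smult_assoc)
qed

lemma in_invariants:
  assumes "act A t = 0" "act B t = 0" "act C t = 0"
  shows "t \<in> invariants"
  unfolding invariants_def
proof (intro CollectI ballI)
  fix N assume "N \<in> (sl2 :: ('k ^ 2 ^ 2) set)"
  then obtain a b c where "N = mat_smult a A + mat_smult b B + mat_smult c C" using span by blast
  then show "act N t = 0" using assms by (simp add: act_simps)
qed

lemma A_x: "act A x = 0"
  using act_square_self[of x] by (simp add: P_xx)

lemma A_B_x: "act A (act B x) = act C x"
  using act_B_A[of x] by (simp add: A_x)

lemma A_C_x: "act A (act C x) = (4 * \<delta>) \<cdot> act B x"
  using act_C_A[of x] by (simp add: A_x)

text \<open>By \<open>act_square\<close>, A v equals -2 \<open>P x v\<close> applied to x. Expanding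
  \<open>P x v\<close> in A, B, C, the A-component drops out because A kills x.\<close>

lemma A_image: "\<exists>b c. act A v = b \<cdot> act B x + c \<cdot> act C x"
proof -
  obtain a b c where "P x v = mat_smult a A + mat_smult b B + mat_smult c C"
    using span[OF P_sl2] by blast
  then have "act A v = (- 2 * b) \<cdot> act B x + (- 2 * c) \<cdot> act C x"
    using act_square[of x v] by (simp add: P_xx act_simps A_x scale_right_distrib)
  then show ?thesis by blast
qed

text \<open>The square of A multiplies both B x and C x by 4 \<delta>, and these span the image of
  A.\<close>

lemma A_cubed: "act A (act A (act A v)) = (4 * \<delta>) \<cdot> act A v"
proof -
  obtain b c where "act A v = b \<cdot> act B x + c \<cdot> act C x" using A_image by blast
  then show ?thesis by (simp add: act_simps A_B_x A_C_x scale_right_distrib mult_ac)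
qed

text \<open>
  On the quadratic expressions in \<open>B\<close>, \<open>C\<close> applied to \<open>x\<close>, the eigenvalues of \<open>A\<^sup>2\<close> are \<open>16 \<delta>\<close>
  and \<open>0\<close>, whereas on the module only \<open>4 \<delta>\<close> and \<open>0\<close> occur.
\<close>

lemma anticommutator_x: "act B (act C x) + act C (act B x) = 0"
  and square_sum_x: "act C (act C x) + (4 * \<delta>) \<cdot> act B (act B x) = 0"
proof -
  define u where "u = act B (act C x) + act C (act B x)"
  define w where "w = act C (act C x) + (4 * \<delta>) \<cdot> act B (act B x)"
  have BB: "act A (act B (act B x)) = u"
    using act_B_A[of "act B x"] by (simp add: A_B_x u_def algebra_simps)
  have CC: "act A (act C (act C x)) = (4 * \<delta>) \<cdot> u"
    using act_C_A[of "act C x"] by (simp add: A_C_x u_def act_simps scale_right_distrib algebra_simps)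
  have BC: "act A (act B (act C x)) = w"
    using act_B_A[of "act C x"] by (simp add: A_C_x w_def act_simps algebra_simps)
  have CB: "act A (act C (act B x)) = w"
    using act_C_A[of "act B x"] by (simp add: A_B_x w_def algebra_simps)
  have Au: "act A u = 2 \<cdot> w"
    unfolding u_def by (simp add: act_simps BC CB scale_two)
  have Aw: "act A w = (8 * \<delta>) \<cdot> u"
    unfolding w_def by (simp add: act_simps BB CC flip: scale_left_distrib)
  have "(16 * \<delta>) \<cdot> act A u = (4 * \<delta>) \<cdot> act A u"
    using A_cubed[of u] by (simp add: Au Aw act_simps)
  then have "(16 * \<delta> - 4 * \<delta>) \<cdot> act A u = 0"
    by (simp only: scale_left_diff_distrib diff_self)
  then have "(12 * \<delta>) \<cdot> act A u = 0"
    by (simp only: left_diff_distrib[symmetric]) simp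
  then have "act A u = 0" using numerals_nonzero \<delta> by simp
  then have w: "w = 0" using Au two by simp
  then have "(8 * \<delta>) \<cdot> u = 0" using Aw by simp
  then show "act B (act C x) + act C (act B x) = 0"
    using numerals_nonzero \<delta> by (simp add: u_def)
  show "act C (act C x) + (4 * \<delta>) \<cdot> act B (act B x) = 0"
    using w by (simp add: w_def)
qed

text \<open>The commutator of C and B is a multiple of A and so kills x. The two products therefore
  agree on x, while \<open>anticommutator_x\<close> says that their sum is zero.\<close>

lemma B_C_x: "act B (act C x) = 0"
  and C_B_x: "act C (act B x) = 0"
  using anticommutator_x act_C_B[of x] by (simp_all add: A_x add_self_eq_0_iff)

text \<open>If x is z plus an invariant vector, with z corresponding to A in a copy of the adjoint
  representation, then B B x = B B z = 4 \<beta> z, because [B, [B, A]] = 4 \<beta> A. The formula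
  solves this for z.\<close>

definition z where "z = inverse (4 * \<beta>) \<cdot> act B (act B x)"

lemma B_B_x: "act B (act B x) = (4 * \<beta>) \<cdot> z"
  using \<beta> numerals_nonzero by (simp add: z_def)

lemma C_C_x: "act C (act C x) = (- 16 * \<delta> * \<beta>) \<cdot> z"
  using square_sum_x by (simp add: B_B_x add_eq_0_iff2)

lemma A_z: "act A z = 0"
  using act_B_A[of "act B x"] by (simp add: z_def act_simps A_B_x B_C_x C_B_x)

text \<open>Moving B past C in B C C x leaves only a multiple of A C x, hence of B x, while C C x is
  a multiple of z. Together with \<open>A_z\<close> and \<open>C_z\<close> this makes x - z
  invariant.\<close>

lemma B_z: "act B z = act B x"
proof -
  have "act B (act C (act C x)) = (- 16 * \<delta> * \<beta>) \<cdot> act B x"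
    using act_C_B[of "act C x"] by (simp add: B_C_x A_C_x add_eq_0_iff2)
  then have "(- 16 * \<delta> * \<beta>) \<cdot> act B z = (- 16 * \<delta> * \<beta>) \<cdot> act B x"
    by (simp only: C_C_x act_scale_right)
  moreover have "- 16 * \<delta> * \<beta> \<noteq> 0"
  proof -
    have "(16::'k) = 4 * 4" by simp
    then show ?thesis using \<delta> \<beta> numerals_nonzero by (metis mult_eq_0_iff neg_equal_0_iff_equal)
  qed
  ultimately show ?thesis using scale_cancel_left by blast
qed

lemma C_z: "act C z = act C x"
proof -
  have "act C (act B (act B x)) = (4 * \<beta>) \<cdot> act C x"
    using act_C_B[of "act B x"] by (simp add: C_B_x A_B_x)
  then show ?thesis using \<beta> numerals_nonzero by (simp add: B_B_x act_scale_right)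
qed

lemma A_B_z: "act A (act B z) = act C z"
  and A_C_z: "act A (act C z) = (4 * \<delta>) \<cdot> act B z"
  and B_B_z: "act B (act B z) = (4 * \<beta>) \<cdot> z"
  and B_C_z: "act B (act C z) = 0"
  and C_B_z: "act C (act B z) = 0"
  and C_C_z: "act C (act C z) = (- 16 * \<delta> * \<beta>) \<cdot> z"
  using A_B_x A_C_x B_B_x B_C_x C_B_x C_C_x by (simp_all add: B_z C_z)

lemmas act_z = A_z A_B_z A_C_z B_B_z B_C_z C_B_z C_C_z

text \<open>Otherwise B x = 0 by \<open>B_z\<close>, and equivariance applied to P x x = A gives
  [B, A] = 0, contradicting the independence of C.\<close>

lemma z_nonzero: "z \<noteq> 0"
proof
  assume "z = 0"
  then have "act B x = 0" "act C x = 0" using B_z C_z by simp_all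
  then have A0: "act A v = 0" for v using A_image[of v] by auto
  then have "act C v = 0" for v using act_B_A[of v] by simp
  then have "act B v = 0" for v using act_C_A[of v] A0 \<delta> numerals_nonzero by simp
  then have "commutator A B = 0"
    using P_equivariant[of B x x] by (simp add: P_xx commutator_def)
  then have "C = 0" by (simp add: AB)
  then show False using indep[of 0 0 1] by simp
qed

text \<open>The vector v is split along the eigenvalues 4 \<delta> and 0 of the square of A. The
  first part lies in the span of B z and C z. On the second part k, both B and C take values in that
  span, and their commutator fixes k up to a multiple of z and an invariant vector.\<close>

lemma decomposition:
  obtains a b c t where "v = a \<cdot> z + b \<cdot> act B z + c \<cdot> act C z + t" "t \<in> invariants"
proof -
  define k where "k = v - inverse (4 * \<delta>) \<cdot> act A (act A v)"
  obtain b c where bc: "act A v = b \<cdot> act B z + c \<cdot> act C z"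
    using A_image[of v] by (auto simp: B_z C_z)
  have Ak: "act A k = 0"
    using \<delta> numerals_nonzero by (simp add: k_def act_simps A_cubed)
  have ABk: "act A (act B k) = act C k" using act_B_A[of k] Ak by simp
  have ACk: "act A (act C k) = (4 * \<delta>) \<cdot> act B k" using act_C_A[of k] Ak by simp
  obtain p q where Ck: "act C k = p \<cdot> act B z + q \<cdot> act C z"
    using A_image[of "act B k"] by (auto simp: B_z C_z ABk)
  have "(4 * \<delta>) \<cdot> act B k = p \<cdot> act C z + (4 * \<delta>) \<cdot> q \<cdot> act B z"
    unfolding ACk[symmetric] by (simp add: Ck act_simps act_z mult_ac)
  then have "inverse (4 * \<delta>) \<cdot> (4 * \<delta>) \<cdot> act B k
      = inverse (4 * \<delta>) \<cdot> (p \<cdot> act C z + (4 * \<delta>) \<cdot> q \<cdot> act B z)"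
    by simp
  then have Bk: "act B k = (inverse (4 * \<delta>) * p) \<cdot> act C z + q \<cdot> act B z"
    using \<delta> numerals_nonzero by (simp add: scale_right_distrib)
  \<comment> \<open>C B and B C agree on k because their difference is a multiple of A, which kills
    k. Comparing the coefficients of z yields p = -p.\<close>
  have "(p * (4 * \<beta>)) \<cdot> z = (inverse (4 * \<delta>) * p * (- 16 * \<delta> * \<beta>)) \<cdot> z"
    using act_C_B[of k] by (simp add: Ck Bk Ak act_simps act_z)
  then have "p * (4 * \<beta>) = inverse (4 * \<delta>) * p * (- 16 * \<delta> * \<beta>)"
    using z_nonzero by (simp only: scale_cancel_right) simp
  moreover have "inverse (4 * \<delta>) * p * (- 16 * \<delta> * \<beta>) = - (p * (4 * \<beta>))"
  proof -
    have "inverse (4 * \<delta>) * p * (- 16 * \<delta> * \<beta>)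
        = - ((inverse (4 * \<delta>) * (4 * \<delta>)) * (p * (4 * \<beta>)))"
      by simp
    then show ?thesis using \<delta> numerals_nonzero by (simp only: left_inverse mult_eq_0_iff) simp
  qed
  ultimately have "p * (4 * \<beta>) = - (p * (4 * \<beta>))" by (rule trans)
  then have "2 * (p * (4 * \<beta>)) = 0" by (simp only: mult_2 add_eq_0_iff2)
  then have p: "p = 0" using \<beta> two numerals_nonzero by simp
  have t: "k - q \<cdot> z \<in> invariants"
    using p Bk Ck by (intro in_invariants) (simp_all add: act_simps Ak act_z)
  have "v = q \<cdot> z + (inverse (4 * \<delta>) * (4 * \<delta> * c)) \<cdot> act B z + (inverse (4 * \<delta>) * b) \<cdot> act C z
      + (k - q \<cdot> z)"
    by (simp add: k_def bc act_simps act_z scale_right_distrib algebra_simps)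
  then show ?thesis using t that by blast
qed

section \<open>The form P on the copy of the adjoint representation\<close>

lemma centralizer_A:
  assumes "M \<in> sl2" and "commutator A M = 0"
  obtains a where "M = mat_smult a A"
proof -
  obtain a b c where M: "M = mat_smult a A + mat_smult b B + mat_smult c C"
    using span[OF assms(1)] by blast
  \<comment> \<open>Bracketing with A sends B to C and C to 4 \<delta> B, so a matrix commuting with
    A has only an A-component.\<close>
  have "commutator A M = mat_smult 0 A + mat_smult (c * (4 * \<delta>)) B + mat_smult b C"
    unfolding M commutator_add_right commutator_smult_right by (simp add: commutator_self AB AC mat_smult_assoc)
  then have "c * (4 * \<delta>) = 0 \<and> b = 0" using assms(2) indep by metis
  then have "b = 0" "c = 0" using \<delta> numerals_nonzero by auto
  then show ?thesis using M that by simp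
qed

text \<open>Applying \<open>B\<close> three times to \<open>P z z = 2 \<mu> A\<close> gives \<open>12 \<beta> \<mu> = 0\<close>.\<close>

lemma P_zz: "P z z = 0"
proof -
  have "commutator A (P z z) = 0" by (simp add: P_equivariant A_z)
  then obtain \<kappa> where "P z z = mat_smult \<kappa> A"
    using centralizer_A[OF P_sl2] by blast
  \<comment> \<open>Writing the scalar as 2 \<mu> keeps the values free of fractions: bracketing
    \<open>P z z\<close> with B produces \<open>P (act B z) z\<close> twice.\<close>
  then obtain \<mu> where zz: "P z z = mat_smult (2 * \<mu>) A"
    using that[of "\<kappa> / 2"] two by simp
  have 1: "P (act B z) z = mat_smult (- \<mu>) C"
  proof (rule mat_double_cancel[OF two])
    have "P (act B z) z + P (act B z) z = commutator B (P z z)"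
      by (simp add: P_equivariant P_sym[of z "act B z"])
    then show "P (act B z) z + P (act B z) z = mat_smult (- \<mu>) C + mat_smult (- \<mu>) C"
      by (simp add: zz commutator_smult_right BA mat_smult_assoc mat2_eq_iff)
  qed
  have "P (act B z) (act B z) = commutator B (P (act B z) z) - mat_smult (8 * \<beta> * \<mu>) A"
    by (simp add: P_equivariant act_z P_simps zz mat_smult_assoc mult_ac)
  also have "\<dots> = mat_smult (- 4 * \<beta> * \<mu>) A"
    by (simp add: 1 commutator_smult_right BC mat2_eq_iff algebra_simps)
  finally have "commutator B (mat_smult (- 4 * \<beta> * \<mu>) A) =
      mat_smult (4 * \<beta>) (P (act B z) z) + mat_smult (4 * \<beta>) (P (act B z) z)"
    using P_equivariant[of B "act B z" "act B z"] by (simp add: act_z P_simps P_sym[of z "act B z"])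
  then have *: "mat_smult (4 * \<beta> * \<mu>) C = mat_smult (- 8 * \<beta> * \<mu>) C"
    by (simp add: 1 commutator_smult_right BA mat2_eq_iff algebra_simps)
  have "mat_smult 0 A + mat_smult 0 B + mat_smult (4 * \<beta> * \<mu> - - 8 * \<beta> * \<mu>) C = 0"
    using * by (simp add: mat2_eq_iff algebra_simps)
  then have "4 * \<beta> * \<mu> - - 8 * \<beta> * \<mu> = 0" using indep by blast
  then have "12 * \<beta> * \<mu> = 0" by (simp only: left_diff_distrib[symmetric]) simp
  then show ?thesis using zz \<beta> numerals_nonzero by simp
qed

lemma P_act_z: "P (act N z) z = 0"
proof (rule mat_double_cancel[OF two])
  show "P (act N z) z + P (act N z) z = 0 + 0"
    using P_equivariant[of N z z] by (simp add: P_zz P_sym[of z "act N z"])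
qed

lemma P_Bz_Bz: "P (act B z) (act B z) = 0"
  and P_Bz_Cz: "P (act B z) (act C z) = 0"
  and P_Cz_Cz: "P (act C z) (act C z) = 0"
  using P_equivariant[of B "act B z" z] P_equivariant[of C "act B z" z] P_equivariant[of C "act C z" z]
  by (simp_all add: P_act_z act_z P_simps P_minus_left P_zz)

text \<open>The subrepresentation generated by z. The map sending u to \<open>P u r\<close>
  identifies it with the adjoint representation.\<close>

definition adjoint_copy :: "'v set" where
  "adjoint_copy = {a \<cdot> z + b \<cdot> act B z + c \<cdot> act C z | a b c. True}"

lemma P_adjoint_copy: "u \<in> adjoint_copy \<Longrightarrow> v \<in> adjoint_copy \<Longrightarrow> P u v = 0"
  by (auto simp: adjoint_copy_def P_simps P_zz P_act_z P_Bz_Bz P_Bz_Cz P_Cz_Cz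
      P_sym[of z "act B z"] P_sym[of z "act C z"] P_sym[of "act C z" "act B z"])

lemma adjoint_copyI: "a \<cdot> z + b \<cdot> act B z + c \<cdot> act C z \<in> adjoint_copy"
  by (auto simp: adjoint_copy_def)

lemma adjoint_copy_add:
  assumes "u \<in> adjoint_copy" "v \<in> adjoint_copy"
  shows "u + v \<in> adjoint_copy"
proof -
  obtain a b c a' b' c' where "u = a \<cdot> z + b \<cdot> act B z + c \<cdot> act C z"
    "v = a' \<cdot> z + b' \<cdot> act B z + c' \<cdot> act C z"
    using assms by (auto simp: adjoint_copy_def)
  then have "u + v = (a + a') \<cdot> z + (b + b') \<cdot> act B z + (c + c') \<cdot> act C z"
    by (simp add: algebra_simps scale_left_distrib)
  then show ?thesis using adjoint_copyI by metis
qed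

lemma adjoint_copy_scale: "u \<in> adjoint_copy \<Longrightarrow> k \<cdot> u \<in> adjoint_copy"
  using adjoint_copyI by (fastforce simp: adjoint_copy_def scale_right_distrib)

lemma adjoint_copy_diff: "u \<in> adjoint_copy \<Longrightarrow> v \<in> adjoint_copy \<Longrightarrow> u - v \<in> adjoint_copy"
  using adjoint_copy_add[of u "-1 \<cdot> v"] adjoint_copy_scale[of v "-1"] by simp

lemma adjoint_copy_act:
  assumes "u \<in> adjoint_copy" "N \<in> sl2"
  shows "act N u \<in> adjoint_copy"
proof -
  obtain a b c where u: "u = a \<cdot> z + b \<cdot> act B z + c \<cdot> act C z"
    using assms by (auto simp: adjoint_copy_def)
  obtain p q s where N: "N = mat_smult p A + mat_smult q B + mat_smult s C"
    using span[OF assms(2)] by blast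
  have "act A u = 0 \<cdot> z + (c * (4 * \<delta>)) \<cdot> act B z + b \<cdot> act C z"
    "act B u = (b * (4 * \<beta>)) \<cdot> z + a \<cdot> act B z + 0 \<cdot> act C z"
    "act C u = (c * (- 16 * \<delta> * \<beta>)) \<cdot> z + 0 \<cdot> act B z + a \<cdot> act C z"
    by (simp_all add: u act_simps act_z)
  then have "act A u \<in> adjoint_copy" "act B u \<in> adjoint_copy" "act C u \<in> adjoint_copy"
    using adjoint_copyI by metis+
  then show ?thesis
    unfolding N by (simp add: act_simps adjoint_copy_add adjoint_copy_scale)
qed

text \<open>The factor 2 normalises \<open>P z r\<close> to A: the cross term of z and x - z occurs
  twice in P x x = A.\<close>

definition r where "r = 2 \<cdot> (x - z)"

lemma r_invariant: "r \<in> invariants"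
  unfolding r_def
  by (intro invariants_scale in_invariants) (simp_all add: act_simps A_x A_z B_z C_z)

text \<open>In the expansion of P x x along x = z + (x - z), the square of z vanishes by
  \<open>P_zz\<close> and that of x - z by \<open>P_invariants\<close>, so only the cross terms
  remain.\<close>

lemma P_z_r: "P z r = A"
proof -
  have inv: "x - z \<in> invariants"
    by (intro in_invariants) (simp_all add: act_simps A_x A_z B_z C_z)
  have "A = P (z + (x - z)) (z + (x - z))" by (simp add: P_xx)
  also have "\<dots> = P z (x - z) + P z (x - z)"
    unfolding P_add_left P_add_right using P_invariants[OF inv inv] by (simp add: P_zz P_sym[of "x - z" z])
  also have "\<dots> = P z r" by (simp only: r_def scale_two P_add_right)
  finally show ?thesis by simp
qed

lemma P_act_invariant: "t \<in> invariants \<Longrightarrow> N \<in> sl2 \<Longrightarrow> P (act N v) t = commutator N (P v t)"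
  by (simp add: P_equivariant invariants_def)

lemma P_adjoint_r:
  "P (a \<cdot> z + b \<cdot> act B z + c \<cdot> act C z) r
    = mat_smult a A + mat_smult (- 4 * \<delta> * c) B + mat_smult (- b) C"
  by (simp add: P_simps P_act_invariant r_invariant P_z_r B_sl2 C_sl2 BA CA mat_smult_assoc algebra_simps)

lemma P_adjoint_r_inj:
  assumes "u \<in> adjoint_copy" "P u r = 0"
  shows "u = 0"
proof -
  obtain a b c where u: "u = a \<cdot> z + b \<cdot> act B z + c \<cdot> act C z"
    using assms by (auto simp: adjoint_copy_def)
  then have "a = 0 \<and> - 4 * \<delta> * c = 0 \<and> - b = 0"
    using assms P_adjoint_r indep by metis
  then show ?thesis using u \<delta> numerals_nonzero by simp
qed

lemma P_adjoint_r_surj: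
  assumes "M \<in> sl2"
  shows "\<exists>u\<in>adjoint_copy. P u r = M"
proof -
  obtain a b c where M: "M = mat_smult a A + mat_smult b B + mat_smult c C"
    using span[OF assms] by blast
  have "P (a \<cdot> z + (- c) \<cdot> act B z + (- b / (4 * \<delta>)) \<cdot> act C z) r = M"
    unfolding P_adjoint_r M using \<delta> numerals_nonzero by simp
  then show ?thesis using adjoint_copyI by blast
qed

text \<open>An argument in the spirit of Schur: A kills z, so \<open>P z t\<close> commutes with A
  and is a multiple k of A = \<open>P z r\<close>. Equivariance carries the same k to B z and C
  z.\<close>

lemma P_adjoint_invariant:
  assumes t: "t \<in> invariants"
  obtains k where "\<And>u. u \<in> adjoint_copy \<Longrightarrow> P u t = mat_smult k (P u r)"
proof -
  have "commutator A (P z t) = 0"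
    using P_act_invariant[OF t A_sl2, of z] by (simp add: A_z)
  then obtain k where k: "P z t = mat_smult k A"
    using centralizer_A[OF P_sl2] by blast
  have "P u t = mat_smult k (P u r)" if u: "u \<in> adjoint_copy" for u
  proof -
    have B: "P (act B z) t = mat_smult k (P (act B z) r)" and C: "P (act C z) t = mat_smult k (P (act C z) r)"
      by (simp_all add: P_act_invariant t r_invariant B_sl2 C_sl2 k P_z_r commutator_smult_right)
    show ?thesis
      using u by (auto simp: adjoint_copy_def P_simps B C k P_z_r mat2_eq_iff algebra_simps)
  qed
  then show ?thesis using that by blast
qed

text \<open>The map \<psi> inverts u \<mapsto> \<open>P u r\<close> on the adjoint copy. Its
  linearity and equivariance follow by applying that injective map to both sides, r being
  invariant.\<close>

lemma semisimple_square_decomposition: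
  obtains \<psi> r where
    "\<And>M N. M \<in> sl2 \<Longrightarrow> N \<in> sl2 \<Longrightarrow> \<psi> (M + N) = \<psi> M + \<psi> N"
    "\<And>c M. M \<in> sl2 \<Longrightarrow> \<psi> (mat_smult c M) = c \<cdot> \<psi> M"
    "\<And>M N. M \<in> sl2 \<Longrightarrow> N \<in> sl2 \<Longrightarrow> act N (\<psi> M) = \<psi> (commutator N M)"
    "\<And>M N. M \<in> sl2 \<Longrightarrow> N \<in> sl2 \<Longrightarrow> P (\<psi> M) (\<psi> N) = 0"
    "r \<in> invariants"
    "\<And>M. M \<in> sl2 \<Longrightarrow> P (\<psi> M) r = M"
    "\<And>v. \<exists>M\<in>sl2. \<exists>s. \<exists>t\<in>radical. v = \<psi> M + s \<cdot> r + t"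
proof -
  obtain \<psi> where mem: "\<And>M. M \<in> sl2 \<Longrightarrow> \<psi> M \<in> adjoint_copy" and P: "\<And>M. M \<in> sl2 \<Longrightarrow> P (\<psi> M) r = M"
    using P_adjoint_r_surj by metis
  have eqI: "u = \<psi> M" if "u \<in> adjoint_copy" "M \<in> sl2" "P u r = M" for u M
  proof -
    have "P (u - \<psi> M) r = 0"
      using P_add_left[of "u - \<psi> M" "\<psi> M" r] that P by simp
    then show ?thesis
      using P_adjoint_r_inj adjoint_copy_diff[OF that(1) mem[OF that(2)]] by fastforce
  qed
  show ?thesis
  proof
    show "\<psi> (M + N) = \<psi> M + \<psi> N" if "M \<in> sl2" "N \<in> sl2" for M N
      using that by (intro eqI[symmetric]) (simp_all add: adjoint_copy_add mem P_simps P)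
    show "\<psi> (mat_smult c M) = c \<cdot> \<psi> M" if "M \<in> sl2" for c M
      using that by (intro eqI[symmetric]) (simp_all add: adjoint_copy_scale mem P_simps P)
    show "act N (\<psi> M) = \<psi> (commutator N M)" if "M \<in> sl2" "N \<in> sl2" for M N
      using that by (intro eqI) (simp_all add: adjoint_copy_act mem P_act_invariant r_invariant P)
    show "P (\<psi> M) (\<psi> N) = 0" if "M \<in> sl2" "N \<in> sl2" for M N
      using that by (simp add: mem P_adjoint_copy)
    show "r \<in> invariants" by (rule r_invariant)
    show "P (\<psi> M) r = M" if "M \<in> sl2" for M using that by (rule P)
    show "\<exists>M\<in>sl2. \<exists>s. \<exists>t\<in>radical. v = \<psi> M + s \<cdot> r + t" for v
    proof -
      obtain u t where v: "v = u + t" and u: "u \<in> adjoint_copy" and t: "t \<in> invariants"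
        using decomposition[of v] adjoint_copyI by metis
      obtain k where k: "\<And>u. u \<in> adjoint_copy \<Longrightarrow> P u t = mat_smult k (P u r)"
        using P_adjoint_invariant[OF t] by blast
      \<comment> \<open>Subtracting k r makes t orthogonal under P to the adjoint copy. It is
        orthogonal to the invariants anyway, so the difference is radical.\<close>
      have inv: "t - k \<cdot> r \<in> invariants"
        using t r_invariant by (simp add: invariants_diff invariants_scale)
      have "P (t - k \<cdot> r) w = 0" for w
      proof -
        obtain u' t' where w: "w = u' + t'" and u': "u' \<in> adjoint_copy" and t': "t' \<in> invariants"
          using decomposition[of w] adjoint_copyI by metis
        have "P u' (t - k \<cdot> r) = 0"
          using P_add_right[of u' "t - k \<cdot> r" "k \<cdot> r"] by (simp add: k[OF u'] P_scale_right)
        then show ?thesis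
          using P_invariants[OF inv t'] by (simp add: w P_add_right P_sym[of "t - k \<cdot> r" u'])
      qed
      then have "t - k \<cdot> r \<in> radical" using inv by (simp add: radical_def)
      moreover have "v = \<psi> (P u r) + k \<cdot> r + (t - k \<cdot> r)"
        using eqI[OF u P_sl2 refl] by (simp add: v)
      ultimately show ?thesis using P_sl2 by blast
    qed
  qed
qed

end

context sl2_odd_module
begin

lemma semisimple_case:
  assumes "det (P x x) \<noteq> 0"
  obtains \<psi> r where
    "\<And>M N. M \<in> sl2 \<Longrightarrow> N \<in> sl2 \<Longrightarrow> \<psi> (M + N) = \<psi> M + \<psi> N"
    "\<And>c M. M \<in> sl2 \<Longrightarrow> \<psi> (mat_smult c M) = c \<cdot> \<psi> M"
    "\<And>M N. M \<in> sl2 \<Longrightarrow> N \<in> sl2 \<Longrightarrow> act N (\<psi> M) = \<psi> (commutator N M)"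
    "\<And>M N. M \<in> sl2 \<Longrightarrow> N \<in> sl2 \<Longrightarrow> P (\<psi> M) (\<psi> N) = 0"
    "r \<in> invariants"
    "\<And>M. M \<in> sl2 \<Longrightarrow> P (\<psi> M) r = M"
    "\<And>v. \<exists>M\<in>sl2. \<exists>s. \<exists>t\<in>radical. v = \<psi> M + s \<cdot> r + t"
proof -
  obtain B C \<delta> \<beta> where *: "\<delta> \<noteq> 0" "\<beta> \<noteq> 0" "B \<in> sl2" "commutator (P x x) B = C"
    "commutator (P x x) C = mat_smult (4 * \<delta>) B" "commutator B C = mat_smult (- 4 * \<beta>) (P x x)"
    "\<And>M. M \<in> sl2 \<Longrightarrow> \<exists>a b c. M = mat_smult a (P x x) + mat_smult b B + mat_smult c C"
    "\<And>a b c. mat_smult a (P x x) + mat_smult b B + mat_smult c C = 0 \<Longrightarrow> a = 0 \<and> b = 0 \<and> c = 0"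
    by (rule orthogonal_triple[OF two P_sl2 assms]) (rule that)
  interpret semisimple_square scale act P x "P x x" B C \<delta> \<beta>
    by unfold_locales (rule refl P_sl2 * | assumption)+
  show ?thesis by (rule semisimple_square_decomposition) (rule that)
qed

end


section \<open>All squares in the nilpotent cone\<close>

context sl2_odd_module
begin

text \<open>Up to sign and a factor 2, this trace is the coefficient of t in the quartic polynomial
  det P(x + t v, x + t v), which vanishes at every t.\<close>

lemma square_isotropic:
  assumes nil: "\<And>v. det (P v v) = 0"
  shows "trace (P x x ** P x v) = 0"
proof -
  define a b c where abc: "a = P x x$1$1" "b = P x x$1$2" "c = P x x$2$1"
  define a' b' c' where abc': "a' = P x v$1$1" "b' = P x v$1$2" "c' = P x v$2$1"
  define a'' b'' c'' where abc'': "a'' = P v v$1$1" "b'' = P v v$1$2" "c'' = P v v$2$1"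
  have d: "P x x$2$2 = - a" "P x v$2$2 = - a'" "P v v$2$2 = - a''"
    using P_sl2 by (simp_all add: abc abc' abc'' mem_sl2_iff[symmetric])
  have eq: "(a + 2 * t * a' + t * t * a'') * (a + 2 * t * a' + t * t * a'')
      + (b + 2 * t * b' + t * t * b'') * (c + 2 * t * c' + t * t * c'') = 0" for t
  proof -
    have "P (x + t \<cdot> v) (x + t \<cdot> v)
        = P x x + mat_smult (2 * t) (P x v) + mat_smult (t * t) (P v v)"
      by (simp add: P_simps P_sym[of v x] mat2_eq_iff algebra_simps)
    then show ?thesis
      using nil[of "x + t \<cdot> v"] unfolding det_sl2[OF P_sl2] neg_equal_0_iff_equal
      by (simp add: abc abc' abc'')
  qed
  \<comment> \<open>For a quartic f, the combination 8 (f(1) - f(-1)) - (f(2) - f(-2)) is 12 times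
    the linear coefficient, here itself twice the trace.\<close>
  have "2 * (2 * (2 * (2 * (3 * (2 * a * a' + b * c' + c * b'))))) = 0"
    using eq[of 1] eq[of "-1"] eq[of 2] eq[of "-2"] by algebra
  then have "2 * a * a' + b * c' + c * b' = 0"
    using two three by (metis mult_eq_0_iff)
  then show ?thesis
    by (simp add: trace_mat2 matrix_mult_nth2 d abc[symmetric] abc'[symmetric] algebra_simps)
qed

abbreviation "E \<equiv> mat2 0 1 0 0"
abbreviation "F \<equiv> mat2 0 0 1 0"
abbreviation "H \<equiv> mat2 1 0 0 (- 1)"

lemma act_eq_EFH:
  assumes "M \<in> sl2"
  shows "act M v = M$1$1 \<cdot> act H v + M$1$2 \<cdot> act E v + M$2$1 \<cdot> act F v"
proof -
  have "M = mat_smult (M$1$1) H + mat_smult (M$1$2) E + mat_smult (M$2$1) F"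
    using assms by (simp add: mat2_eq_iff mem_sl2_iff)
  then have "act M v = act (mat_smult (M$1$1) H + mat_smult (M$1$2) E + mat_smult (M$2$1) F) v"
    by simp
  then show ?thesis by (simp only: act_simps)
qed

lemma H_E: "commutator H E = mat_smult 2 E"
  and H_F: "commutator H F = mat_smult (- 2) F"
  and E_F: "commutator E F = H"
  by (simp_all add: mat2_simps)

lemma act_E_H: "act E (act H v) = act H (act E v) - 2 \<cdot> act E v"
  using act_commutator[of H E v] unfolding H_E by (simp add: act_simps algebra_simps)

lemma act_F_H: "act F (act H v) = act H (act F v) + 2 \<cdot> act F v"
  using act_commutator[of H F v] unfolding H_F by (simp add: act_simps algebra_simps)

lemma act_E_F: "act E (act F v) = act F (act E v) + act H v"
  using act_commutator[of E F v] unfolding E_F by (simp add: algebra_simps)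

text \<open>The normalisation of \<open>P x x\<close> is the value of \<open>osp_odd_bracket\<close>
  on the first basis vector paired with itself.\<close>

context
  fixes x
  assumes nil: "\<And>v. det (P v v) = 0" and P_xx: "P x x = mat2 0 2 0 0"
begin

lemma mat2_scale_E: "mat2 0 a 0 0 = mat_smult a E"
  by (simp add: mat2_eq_iff)

lemma E_x: "act E x = 0"
  using act_square_self[of x] two by (simp add: P_xx mat2_scale_E[of 2] act_simps)

text \<open>Orthogonality of \<open>P x v\<close> to 2 E removes its F-component, and E kills x, so
  \<open>act_square\<close> leaves only a multiple of H x.\<close>

lemma E_image: "\<exists>c. act E v = c \<cdot> act H x"
proof -
  have 21: "P x v $ 2 $ 1 = 0"
    using square_isotropic[OF nil, of x v] two by (simp add: trace_mat2 matrix_mult_nth2 P_xx)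
  have "2 \<cdot> act E v = 2 \<cdot> (- (P x v $ 1 $ 1)) \<cdot> act H x"
    using act_square[of x v] act_eq_EFH[OF P_sl2, of x v x]
    by (simp add: P_xx mat2_scale_E[of 2] act_simps 21 E_x)
  then show ?thesis using two by (metis scale_cancel_left)
qed

text \<open>The candidate is H x, which spans the image of E. Since E F w = H w lies in that image,
  w is an eigenvector of H; it remains to find the eigenvalue.\<close>

lemma highest_weight_vector:
  obtains w where "act E w = 0" "act H w = w" "P w w = mat2 0 2 0 0" "\<And>v. \<exists>c. act E v = c \<cdot> w"
proof -
  define w where "w = act H x"
  have E_w: "act E w = 0" by (simp add: w_def act_E_H E_x)
  have "act E (act F w) = act H w" by (simp add: act_E_F E_w)
  then obtain \<mu> where \<mu>: "act H w = \<mu> \<cdot> w" using E_image[of "act F w"] by (auto simp: w_def)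
  \<comment> \<open>The left side is a multiple of w and so is killed by E. As E F w = H w and E F x
    = w, applying E to the right side forces H w = w.\<close>
  have "act E (act F (act F x)) = 2 \<cdot> act F w - 2 \<cdot> act F x"
    using act_F_H[of x] by (simp add: act_E_F E_x w_def scale_two algebra_simps)
  then obtain c where "2 \<cdot> act F w - 2 \<cdot> act F x = c \<cdot> w"
    using E_image[of "act F (act F x)"] by (auto simp: w_def)
  then have "act E (2 \<cdot> act F w - 2 \<cdot> act F x) = act E (c \<cdot> w)" by simp
  then have "2 \<cdot> \<mu> \<cdot> w = 2 \<cdot> w"
    by (simp only: act_simps act_E_F E_w \<mu> E_x) (simp add: w_def)
  then have "\<mu> \<cdot> w = w" using two by (metis scale_cancel_left)
  then have H_w: "act H w = w" by (simp add: \<mu>)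
  \<comment> \<open>Bracketing with H replaces x by w = H x one argument at a time, which carries
    the value 2 E from \<open>P x x\<close> to \<open>P w x\<close> and then to
    \<open>P w w\<close>.\<close>
  have "P w x + P w x = commutator H (P x x)"
    by (simp only: P_equivariant P_sym[of x "act H x"] w_def)
  also have "\<dots> = mat2 0 2 0 0 + mat2 0 2 0 0" by (simp add: P_xx mat2_simps)
  finally have wx: "P w x = mat2 0 2 0 0" by (rule mat_double_cancel[OF two])
  have "P w x + P w w = P (act H w) x + P w (act H x)" by (simp only: H_w w_def[symmetric])
  also have "\<dots> = commutator H (P w x)" by (simp only: P_equivariant)
  also have "\<dots> = mat2 0 4 0 0" by (simp add: wx mat2_simps)
  finally have "P w w = mat2 0 2 0 0"
    by (simp add: wx mat2_eq_iff algebra_simps)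
  then show ?thesis
    using that[of w] E_w H_w E_image by (simp add: w_def)
qed

end

lemma nilpotent_square_decomposition:
  assumes nil: "\<And>v. det (P v v) = 0" and P_xx: "P x x = mat2 0 2 0 0"
  obtains G where
    "\<And>v w. G (v + w) = G v + G w"
    "\<And>c v. G (c *s v) = c \<cdot> G v"
    "\<And>M v. M \<in> sl2 \<Longrightarrow> act M (G v) = G (M *v v)"
    "\<And>v w. P (G v) (G w) = osp_odd_bracket v w"
    "\<And>u. \<exists>v. \<exists>t\<in>radical. u = G v + t"
proof -
  obtain x where E_x: "act E x = 0" and H_x: "act H x = x" and xx: "P x x = mat2 0 2 0 0"
    and E_image: "\<And>v. \<exists>c. act E v = c \<cdot> x"
    using highest_weight_vector[OF nil P_xx] by blast
  define y where "y = act F x"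
  have E_y: "act E y = x" by (simp add: y_def act_E_F E_x H_x)
  have H_y: "act H y = - y" using act_F_H[of x] by (simp add: y_def H_x scale_two eq_neg_iff_add_eq_0 add_ac)
  have xy: "P x y = mat2 (- 1) 0 0 1"
  proof (rule mat_double_cancel[OF two])
    have "P x y + P x y = commutator F (P x x)" by (simp add: P_equivariant y_def P_sym[of "act F x" x])
    then show "P x y + P x y = mat2 (- 1) 0 0 1 + mat2 (- 1) 0 0 1"
      by (simp add: xx mat2_simps)
  qed
  \<comment> \<open>The aim is u = 0, so that x and y span a standard representation. Once
    \<open>P x u\<close> is zero, \<open>P y y\<close> equals -2 F, and
    \<open>act_square_self\<close> at y gives F y = 0.\<close>
  define u where "u = act F y"
  have H_u: "act H u = (- 3) \<cdot> u"
  proof -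
    have "- u = act H u + 2 \<cdot> u" using act_F_H[of y] by (simp add: u_def H_y act_minus_right)
    then have "act H u = - (1 \<cdot> u + 2 \<cdot> u)" by (simp add: eq_diff_eq algebra_simps)
    also have "\<dots> = (- 3) \<cdot> u" by (simp only: scale_left_distrib[symmetric] scale_minus_left) simp
    finally show ?thesis .
  qed
  \<comment> \<open>This matrix has weight 1 - 3 = -2 under H, so it is a multiple of F;
    orthogonality to P x x = 2 E excludes a nonzero multiple.\<close>
  have xu: "P x u = 0"
  proof -
    have "P x u $ 2 $ 1 = 0"
      using square_isotropic[OF nil, of x u] two by (simp add: trace_mat2 matrix_mult_nth2 xx)
    moreover have "commutator H (P x u) = P x u + mat_smult (- 3) (P x u)"
      using P_equivariant[of H x u] by (simp only: H_x H_u P_scale_right)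
    ultimately show ?thesis
      using P_sl2[of x u] two numerals_nonzero by (simp add: mat2_simps mem_sl2_iff)
  qed
  have yy: "P y y = mat2 0 0 (- 2) 0"
    using P_equivariant[of F x y] xu by (simp add: y_def[symmetric] u_def[symmetric] xy mat2_simps)
  have F: "act (P y y) v = (- 2) \<cdot> act F v" for v
    using act_eq_EFH[OF P_sl2, of y y v] by (simp add: yy)
  have u0: "u = 0" using act_square_self[of y] two by (simp add: F u_def)
  have F_image: "\<exists>c. act F v = c \<cdot> y" for v
  proof -
    have 12: "P y v $ 1 $ 2 = 0"
      using square_isotropic[OF nil, of y v] two by (simp add: trace_mat2 matrix_mult_nth2 yy)
    have y: "act (P y v) y = (- (P y v $ 1 $ 1)) \<cdot> y"
      using act_eq_EFH[OF P_sl2, of y v y] u0 by (simp add: 12 H_y u_def)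
    have "(- 2) \<cdot> act F v = (- 2) \<cdot> (- (P y v $ 1 $ 1)) \<cdot> y"
      using act_square[of y v] by (simp only: F y)
    moreover have "(- 2 :: 'k) \<noteq> 0" using two by simp
    ultimately show ?thesis by (metis scale_cancel_left)
  qed
  have invariantsI: "t \<in> invariants" if "act E t = 0" "act F t = 0" for t
    using that act_E_F[of t] act_eq_EFH[of _ t] by (simp add: invariants_def)
  have dec: "\<exists>a b t. v = a \<cdot> x + b \<cdot> y + t \<and> t \<in> invariants" for v
  proof -
    obtain a b where a: "act E v = a \<cdot> x" and b: "act F v = b \<cdot> y" using E_image F_image by blast
    \<comment> \<open>E y = x and F x = y, so a is the coefficient of y and b that of x.\<close>
    have "v - b \<cdot> x - a \<cdot> y \<in> invariants"
      using u0 by (intro invariantsI) (simp_all add: act_simps a b E_x E_y y_def[symmetric] u_def[symmetric])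
    moreover have "v = b \<cdot> x + a \<cdot> y + (v - b \<cdot> x - a \<cdot> y)" by simp
    ultimately show ?thesis by blast
  qed
  have radicalI: "t \<in> radical" if t: "t \<in> invariants" for t
  proof -
    have EFH_t: "act E t = 0" "act F t = 0" "act H t = 0"
      using t by (simp_all add: invariants_def mem_sl2_iff)
    have "commutator H (P x t) = P x t"
      using P_equivariant[of H x t] by (simp add: H_x EFH_t)
    \<comment> \<open>\<open>P x t\<close> has weight 1 under H, whereas the weights on sl(2) are 0,
      2 and -2. The weights 1 and -2 differ because 3 is nonzero.\<close>
    moreover have "(2::'k) \<noteq> 1" by (metis add_cancel_right_right one_add_one one_neq_zero)
    ultimately have xt: "P x t = 0"
      using P_sl2[of x t] three by (simp add: mat2_simps mem_sl2_iff)
    then have yt: "P y t = 0"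
      using P_equivariant[of F x t] by (simp add: y_def EFH_t)
    have "P t v = 0" for v
    proof -
      obtain a b t' where "v = a \<cdot> x + b \<cdot> y + t'" "t' \<in> invariants" using dec by blast
      then show ?thesis
        using P_invariants[OF t, of t'] by (simp add: P_simps xt yt P_sym[of t x] P_sym[of t y])
    qed
    then show ?thesis using t by (simp add: radical_def)
  qed
  define G where "G v = (v$1) \<cdot> x + (v$2) \<cdot> y" for v :: "'k ^ 2"
  show ?thesis
  proof
    show "G (v + w) = G v + G w" for v w by (simp add: G_def algebra_simps scale_left_distrib)
    show "G (c *s v) = c \<cdot> G v" for c v by (simp add: G_def scale_right_distrib)
    show "act M (G v) = G (M *v v)" if "M \<in> sl2" for M v
    proof -
      have x: "act M x = M$1$1 \<cdot> x + M$2$1 \<cdot> y"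
        using act_eq_EFH[OF that, of x] by (simp add: E_x H_x y_def)
      have y: "act M y = M$1$2 \<cdot> x - M$1$1 \<cdot> y"
        using act_eq_EFH[OF that, of y] u0 by (simp add: E_y H_y u_def)
      show ?thesis
        using that by (simp add: G_def act_simps x y mem_sl2_iff matrix_vector_mult_def sum_2
            algebra_simps scale_left_distrib scale_right_distrib scale_right_diff_distrib)
    qed
    show "P (G v) (G w) = osp_odd_bracket v w" for v w
      by (simp add: G_def P_simps xx xy yy P_sym[of y x] osp_odd_bracket_def Let_def mat2_def[symmetric]
          mat2_eq_iff algebra_simps)
    show "\<exists>w. \<exists>t\<in>radical. v = G w + t" for v
    proof -
      obtain a b t where v: "v = a \<cdot> x + b \<cdot> y + t" and t: "t \<in> invariants" using dec by blast
      then have "v = G (vector [a, b]) + t" by (simp add: G_def vector_2)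
      then show ?thesis using radicalI[OF t] by blast
    qed
  qed
qed

end

section \<open>Conjugation, inverses of isomorphisms and projection onto sl(2)\<close>

lemma nilpotent_conjugate:
  fixes A :: "'k::field ^ 2 ^ 2"
  assumes two: "(2::'k) \<noteq> 0" and "A \<in> sl2" "det A = 0" "A \<noteq> 0"
  obtains g g' where "g ** g' = mat 1" "g' ** g = mat 1" "A = g ** mat2 0 2 0 0 ** g'"
proof -
  define a b c where abc: "a = A$1$1" "b = A$1$2" "c = A$2$1"
  have d: "A$2$2 = - a" using assms by (simp add: abc mem_sl2_iff)
  have sq: "a * a + b * c = 0"
    using assms d by (simp add: det_2 abc[symmetric]) (metis add.inverse_inverse add_eq_0_iff)
  show ?thesis
  proof (cases "b = 0")
    case False
    then have "c = - (a * a / b)" using sq by (simp add: field_simps add_eq_0_iff2)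
    \<comment> \<open>The columns of g are a vector in the kernel of A and a vector that A sends to
      twice the first one.\<close>
    with False show ?thesis
      by (intro that[of "mat2 b 0 (- a) 2" "mat2 (1 / b) 0 (a / (2 * b)) (1 / 2)"])
        (use two in \<open>simp_all add: mat2_eq_iff matrix_mult_nth2 mat_def d abc[symmetric] field_simps\<close>)
  next
    case True
    then have "a = 0" using sq by simp
    then have "c \<noteq> 0" using True assms(4) d by (auto simp: mat2_eq_iff abc[symmetric])
    with True \<open>a = 0\<close> show ?thesis
      by (intro that[of "mat2 0 2 c 0" "mat2 0 (1 / c) (1 / 2) 0"])
        (use two in \<open>simp_all add: mat2_eq_iff matrix_mult_nth2 mat_def d abc[symmetric]\<close>)
  qed
qed


lemma bit_exhaust: "(\<alpha>::bit) = 0 \<or> \<alpha> = 1"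
  using bit_not_zero_iff by blast

lemma koszul_simps [simp]: "koszul 0 \<beta> = 1" "koszul \<alpha> 0 = 1" "koszul 1 1 = - 1"
  by (simp_all add: koszul_def)

text \<open>In the third case the isomorphism is built starting from the direct sum and has to be
  reversed. The closure conditions allow an equation in the carrier of L to be checked after
  applying the injective f.\<close>

lemma superalgebra_iso_inv_into:
  assumes f: "superalgebra_iso f L M"
    and parts: "\<And>\<alpha>. part L \<alpha> \<subseteq> carr L"
    and add: "\<And>x y. x \<in> carr L \<Longrightarrow> y \<in> carr L \<Longrightarrow> x + y \<in> carr L"
    and smul: "\<And>c x. x \<in> carr L \<Longrightarrow> smul L c x \<in> carr L"
    and bracket: "\<And>x y. x \<in> carr L \<Longrightarrow> y \<in> carr L \<Longrightarrow> bracket L x y \<in> carr L"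
  shows "superalgebra_iso (inv_into (carr L) f) M L"
proof -
  let ?g = "inv_into (carr L) f"
  have bij: "bij_betw f (carr L) (carr M)"
    and part: "\<And>\<alpha>. f ` part L \<alpha> = part M \<alpha>"
    and hom: "\<And>x y. x \<in> carr L \<Longrightarrow> y \<in> carr L \<Longrightarrow> f (x + y) = f x + f y"
      "\<And>c x. x \<in> carr L \<Longrightarrow> f (smul L c x) = smul M c (f x)"
      "\<And>x y. x \<in> carr L \<Longrightarrow> y \<in> carr L \<Longrightarrow> f (bracket L x y) = bracket M (f x) (f y)"
    using f by (auto simp: superalgebra_iso_def)
  have mem: "?g x \<in> carr L" and fg: "f (?g x) = x" if "x \<in> carr M" for x
    using bij that by (auto simp: bij_betw_def inv_into_into f_inv_into_f)
  have eqI: "?g x = y" if "y \<in> carr L" "f y = x" for x y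
    using bij that by (auto simp: bij_betw_def)
  show ?thesis
    unfolding superalgebra_iso_def
  proof (intro conjI allI ballI)
    show "bij_betw ?g (carr M) (carr L)" using bij by (rule bij_betw_inv_into)
    show "?g ` part M \<alpha> = part L \<alpha>" for \<alpha>
      using bij parts[of \<alpha>] by (simp add: part[symmetric] bij_betw_def inv_into_image_cancel)
    show "?g (x + y) = ?g x + ?g y" if "x \<in> carr M" "y \<in> carr M" for x y
      using that by (intro eqI) (simp_all add: mem fg hom add)
    show "?g (smul M c x) = smul L c (?g x)" if "x \<in> carr M" for c x
      using that by (intro eqI) (simp_all add: mem fg hom smul)
    show "?g (bracket M x y) = bracket L (?g x) (?g y)" if "x \<in> carr M" "y \<in> carr M" for x y
      using that by (intro eqI) (simp_all add: mem fg hom bracket)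
  qed
qed

text \<open>For invertible 2 this is the projection onto sl(2) along the scalar matrices. Scalars
  are central, so commutators do not change.\<close>

definition traceless :: "'k::field ^ 2 ^ 2 \<Rightarrow> 'k ^ 2 ^ 2" where
  "traceless A = mat2 ((A$1$1 - A$2$2) / 2) (A$1$2) (A$2$1) ((A$2$2 - A$1$1) / 2)"

lemma traceless_sl2 [simp]: "traceless A \<in> sl2"
  by (simp add: traceless_def mem_sl2_iff minus_divide_left)

lemma traceless_id: "(2::'k::field) \<noteq> 0 \<Longrightarrow> A \<in> sl2 \<Longrightarrow> traceless A = (A :: 'k ^ 2 ^ 2)"
  by (simp add: traceless_def mem_sl2_iff mat2_eq_iff flip: mult_2)

lemma traceless_add: "traceless (A + B) = traceless A + traceless B"
  and traceless_smult: "traceless (mat_smult c A) = mat_smult c (traceless A)"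
  by (simp_all add: traceless_def mat2_eq_iff add_divide_distrib diff_divide_distrib algebra_simps)

lemma commutator_traceless:
  assumes "(2::'k::field) \<noteq> 0"
  shows "commutator (traceless A) (traceless B) = commutator A (B :: 'k ^ 2 ^ 2)"
  using assms
  by (simp add: traceless_def mat2_eq_iff commutator_nth diff_divide_distrib algebra_simps)


section \<open>The module of a Lie superalgebra with even part sl(2)\<close>

locale sl2_superalgebra = lie_superalgebra L
  for L :: "('k::field, 'g::ab_group_add) superalgebra" +
  fixes \<iota> :: "'k ^ 2 ^ 2 \<Rightarrow> 'g"
  assumes even: "even_part_sl2 \<iota> L"
    and two: "(2::'k) \<noteq> 0" and three: "(3::'k) \<noteq> 0"
begin

lemma zero_part: "0 \<in> part L \<alpha>"
  using subspace_part subspace_0 by blast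

lemma even_carr: "x \<in> part L 0 \<Longrightarrow> x \<in> carr L"
  unfolding carr_def using zero_part[of 1] by force

lemma odd_carr: "x \<in> part L 1 \<Longrightarrow> x \<in> carr L"
  unfolding carr_def using zero_part[of 0] by force

lemma part_carr: "part L \<alpha> \<subseteq> carr L"
  using even_carr odd_carr bit_exhaust[of \<alpha>] by auto

lemma part_add: "x \<in> part L \<alpha> \<Longrightarrow> y \<in> part L \<alpha> \<Longrightarrow> x + y \<in> part L \<alpha>"
  and part_smul: "x \<in> part L \<alpha> \<Longrightarrow> smul L c x \<in> part L \<alpha>"
  using subspace_part[of \<alpha>] by (auto intro: subspace_add subspace_scale)

lemma carr_sl2_algebra: "carr (sl2_algebra :: ('k, 'k ^ 2 ^ 2) superalgebra) = sl2"
  by (auto simp: carr_def sl2_algebra_def)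

lemma carr_even: "carr (sub_superalgebra L (part L 0)) = part L 0"
proof -
  have "part L 1 \<inter> part L 0 = {0}" using parts_independent by (simp add: Int_commute)
  then show ?thesis by (simp add: carr_def sub_superalgebra_def)
qed

lemma \<iota>_bij: "bij_betw \<iota> sl2 (part L 0)"
  and \<iota>_add: "A \<in> sl2 \<Longrightarrow> B \<in> sl2 \<Longrightarrow> \<iota> (A + B) = \<iota> A + \<iota> B"
  and \<iota>_smult: "A \<in> sl2 \<Longrightarrow> \<iota> (mat_smult c A) = smul L c (\<iota> A)"
  and \<iota>_commutator: "A \<in> sl2 \<Longrightarrow> B \<in> sl2 \<Longrightarrow> \<iota> (commutator A B) = bracket L (\<iota> A) (\<iota> B)"
  using even unfolding even_part_sl2_def superalgebra_iso_def carr_sl2_algebra carr_even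
  by (simp_all add: sl2_algebra_def sub_superalgebra_def)

lemma \<iota>_even [simp]: "A \<in> sl2 \<Longrightarrow> \<iota> A \<in> part L 0"
  using \<iota>_bij by (auto simp: bij_betw_def)

lemma \<iota>_inj: "A \<in> sl2 \<Longrightarrow> B \<in> sl2 \<Longrightarrow> \<iota> A = \<iota> B \<longleftrightarrow> A = B"
  using \<iota>_bij by (auto simp: bij_betw_def inj_on_def)

lemma \<iota>_zero [simp]: "\<iota> 0 = 0"
  using \<iota>_add[of 0 0] by simp

lemma even_eq_\<iota>: "x \<in> part L 0 \<Longrightarrow> \<exists>A\<in>sl2. x = \<iota> A"
  using \<iota>_bij by (auto simp: bij_betw_def)

lemma carr_cases:
  assumes "x \<in> carr L"
  obtains A v where "A \<in> sl2" "v \<in> part L 1" "x = \<iota> A + v"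
proof -
  obtain x0 v where "x0 \<in> part L 0" "v \<in> part L 1" "x = x0 + v"
    using assms by (auto simp: carr_def)
  then show ?thesis using even_eq_\<iota>[of x0] that by blast
qed

lemma bracket_even_odd: "x \<in> part L 0 \<Longrightarrow> y \<in> part L 1 \<Longrightarrow> bracket L x y \<in> part L 1"
  and bracket_odd_odd: "x \<in> part L 1 \<Longrightarrow> y \<in> part L 1 \<Longrightarrow> bracket L x y \<in> part L 0"
  using bracket_graded[of x 0 y 1] bracket_graded[of x 1 y 1] by simp_all

lemma bracket_odd_even: "x \<in> part L 1 \<Longrightarrow> y \<in> part L 0 \<Longrightarrow> bracket L x y = - bracket L y x"
  and bracket_odd_sym: "x \<in> part L 1 \<Longrightarrow> y \<in> part L 1 \<Longrightarrow> bracket L x y = bracket L y x"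
  using super_antisym[of x 1 y 0] super_antisym[of x 1 y 1] by simp_all

text \<open>
  Extending the action and the odd bracket along projections onto \<open>sl(2)\<close> and onto the odd part
  makes them total bilinear maps, so that no membership conditions occur.
\<close>

lemma module_structure:
  obtains \<pi> act P where
    "sl2_odd_module (smul L) act P"
    "\<And>v. \<pi> v \<in> part L 1" "\<And>v. v \<in> part L 1 \<Longrightarrow> \<pi> v = v"
    "\<And>v w. \<pi> (v + w) = \<pi> v + \<pi> w" "\<And>c v. \<pi> (smul L c v) = smul L c (\<pi> v)"
    "\<And>A v. act A v \<in> part L 1"
    "\<And>A v. A \<in> sl2 \<Longrightarrow> act A v = bracket L (\<iota> A) (\<pi> v)"
    "\<And>v w. \<iota> (P v w) = bracket L (\<pi> v) (\<pi> w)"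
proof -
  interpret vector_space_pair "smul L" "smul L" by unfold_locales
  have "Vector_Spaces.linear (smul L) (smul L) id"
    by (rule linear_id)
  \<comment> \<open>A linear left inverse of the inclusion of the odd part, with values in the odd
    part, is a projection onto it.\<close>
  then obtain \<pi> where "\<pi> ` UNIV \<subseteq> part L 1" and lin: "Vector_Spaces.linear (smul L) (smul L) \<pi>"
    and "\<forall>v\<in>part L 1. \<pi> (id v) = v"
    using linear_exists_left_inverse_on[OF _ subspace_part inj_on_id] by blast
  then have \<pi>: "\<pi> v \<in> part L 1" and \<pi>_id: "v \<in> part L 1 \<Longrightarrow> \<pi> v = v" for v by auto
  have \<pi>_add: "\<pi> (v + w) = \<pi> v + \<pi> w" and \<pi>_scale: "\<pi> (smul L c v) = smul L c (\<pi> v)" for v w c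
    using lin by (simp_all add: Vector_Spaces.linear_def module_hom_def module_hom_axioms_def)
  define act where "act A v = bracket L (\<iota> (traceless A)) (\<pi> v)" for A v
  define P where "P v w = inv_into sl2 \<iota> (bracket L (\<pi> v) (\<pi> w))" for v w
  have act: "act A v \<in> part L 1" for A v
    by (simp add: act_def bracket_even_odd \<pi>)
  have P: "P v w \<in> sl2" and \<iota>_P: "\<iota> (P v w) = bracket L (\<pi> v) (\<pi> w)" for v w
    using \<iota>_bij bracket_odd_odd[OF \<pi>[of v] \<pi>[of w]]
    by (auto simp: P_def bij_betw_def inv_into_into f_inv_into_f)
  have PI: "P v w = A" if "A \<in> sl2" "\<iota> A = bracket L (\<pi> v) (\<pi> w)" for A v w
    using that P \<iota>_P \<iota>_inj by metis
  note carr = even_carr odd_carr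
  have "sl2_odd_module (smul L) act P"
  proof unfold_locales
    fix M N :: "'k ^ 2 ^ 2" and u v w :: 'g and c :: 'k
    show "act (M + N) v = act M v + act N v"
      by (simp add: act_def traceless_add \<iota>_add bracket_add_left carr \<pi>)
    show "act (mat_smult c M) v = smul L c (act M v)"
      by (simp add: act_def traceless_smult \<iota>_smult bracket_smult_left carr \<pi>)
    show "act M (v + w) = act M v + act M w"
      by (simp add: act_def \<pi>_add bracket_add_right carr \<pi>)
    show "act M (smul L c v) = smul L c (act M v)"
      by (simp add: act_def \<pi>_scale bracket_smult_right carr \<pi>)
    show "act (commutator M N) v = act M (act N v) - act N (act M v)"
    proof -
      let ?x = "\<iota> (traceless M)" and ?y = "\<iota> (traceless N)"
      have "act (commutator M N) v = bracket L (bracket L ?x ?y) (\<pi> v)"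
        unfolding act_def
        by (simp add: traceless_id two \<iota>_commutator[symmetric] commutator_traceless)
      also have "\<dots> = - bracket L (\<pi> v) (bracket L ?x ?y)"
        using bracket_odd_even[OF \<pi>[of v], of "bracket L ?x ?y"] bracket_graded[of ?x 0 ?y 0] by simp
      also have "\<dots> = bracket L ?x (bracket L ?y (\<pi> v)) + bracket L ?y (bracket L (\<pi> v) ?x)"
        using super_jacobi[of ?x 0 ?y 0 "\<pi> v" 1] \<pi>[of v] by (simp add: add_eq_0_iff2 add_eq_0_iff)
      also have "bracket L ?y (bracket L (\<pi> v) ?x) = - bracket L ?y (bracket L ?x (\<pi> v))"
        using bracket_smult_right[of ?y "bracket L ?x (\<pi> v)" "-1"]
        by (simp add: bracket_odd_even \<pi> carr bracket_even_odd)
      finally show ?thesis by (simp add: act_def \<pi>_id \<pi> bracket_even_odd)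
    qed
    show "P v w \<in> sl2" by (rule P)
    show "P v w = P w v"
      by (rule PI[OF P]) (simp add: \<iota>_P bracket_odd_sym \<pi>)
    show "P (u + v) w = P u w + P v w"
      by (rule PI) (simp_all add: P \<iota>_add \<iota>_P \<pi>_add bracket_add_left carr \<pi>)
    show "P (smul L c v) w = mat_smult c (P v w)"
      by (rule PI) (simp_all add: P \<iota>_smult \<iota>_P \<pi>_scale bracket_smult_left carr \<pi>)
    show "commutator M (P v w) = P (act M v) w + P v (act M w)"
    proof -
      let ?x = "\<iota> (traceless M)"
      have "\<iota> (commutator M (P v w)) = bracket L ?x (bracket L (\<pi> v) (\<pi> w))"
        using commutator_traceless[OF two, of M "P v w"]
        by (simp add: \<iota>_P[symmetric] traceless_id[OF two P] \<iota>_commutator[symmetric] P)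
      also have "\<dots> = - bracket L (\<pi> v) (bracket L (\<pi> w) ?x) + bracket L (\<pi> w) (bracket L ?x (\<pi> v))"
        using super_jacobi[of ?x 0 "\<pi> v" 1 "\<pi> w" 1] \<pi> by (simp add: add_eq_0_iff2 add_eq_0_iff algebra_simps)
      also have "bracket L (\<pi> v) (bracket L (\<pi> w) ?x) = - bracket L (\<pi> v) (bracket L ?x (\<pi> w))"
        using bracket_smult_right[of "\<pi> v" "bracket L ?x (\<pi> w)" "-1"]
        by (simp add: bracket_odd_even \<pi> carr bracket_even_odd)
      also have "bracket L (\<pi> w) (bracket L ?x (\<pi> v)) = bracket L (bracket L ?x (\<pi> v)) (\<pi> w)"
        by (simp add: bracket_odd_sym bracket_even_odd \<pi>)
      finally have "\<iota> (commutator M (P v w)) = \<iota> (P (act M v) w + P v (act M w))"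
        by (simp add: \<iota>_add P \<iota>_P act_def \<pi>_id \<pi> bracket_even_odd)
      then show ?thesis by (simp add: \<iota>_inj P)
    qed
    show "act (P u v) w + act (P v w) u + act (P w u) v = 0"
    proof -
      have eq: "act (P u v) w = - bracket L (\<pi> w) (bracket L (\<pi> u) (\<pi> v))" for u v w
        using bracket_odd_even[OF \<pi>[of w] bracket_odd_odd[OF \<pi>[of u] \<pi>[of v]]]
        by (simp add: act_def traceless_id[OF two P] \<iota>_P)
      show ?thesis
        unfolding eq using super_jacobi[of "\<pi> u" 1 "\<pi> v" 1 "\<pi> w" 1] \<pi>
        by (simp add: algebra_simps)
    qed
  qed (fact two three)+
  then show ?thesis
  proof (rule that)
    show "act A v = bracket L (\<iota> A) (\<pi> v)" if "A \<in> sl2" for A v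
      using that by (simp add: act_def traceless_id two)
  qed (fact \<pi> \<pi>_id \<pi>_add \<pi>_scale act \<iota>_P)+
qed

text \<open>Bracketing a central element with the even part splits into an even and an odd equation.
  The even one says that the sl(2)-component is central in sl(2), hence zero, so the centre is
  purely odd.\<close>

lemma center_eq:
  "center L = {t \<in> part L 1. (\<forall>N\<in>sl2. bracket L (\<iota> N) t = 0) \<and> (\<forall>v\<in>part L 1. bracket L t v = 0)}"
proof (intro equalityI subsetI)
  fix t assume "t \<in> center L"
  then have t: "t \<in> carr L" and c: "\<And>y. y \<in> carr L \<Longrightarrow> bracket L t y = 0"
    by (auto simp: center_def)
  obtain M t1 where M: "M \<in> sl2" and t1: "t1 \<in> part L 1" and t_eq: "t = \<iota> M + t1"
    using carr_cases[OF t] .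
  have *: "commutator M N = 0 \<and> bracket L t1 (\<iota> N) = 0" if N: "N \<in> sl2" for N
  proof -
    have "\<iota> (commutator M N) + bracket L t1 (\<iota> N) = 0"
      using c[of "\<iota> N"] N M t1 by (simp add: t_eq bracket_add_left even_carr odd_carr \<iota>_commutator)
    moreover have "bracket L t1 (\<iota> N) \<in> part L 1" using bracket_graded[of t1 1 "\<iota> N" 0] t1 N by simp
    moreover have "\<iota> (commutator M N) \<in> part L 0" by simp
    ultimately have "\<iota> (commutator M N) \<in> part L 1 \<and> \<iota> (commutator M N) \<in> part L 0"
      using subspace_neg[OF subspace_part] by (metis add_eq_0_iff2)
    then have "\<iota> (commutator M N) = 0" using parts_independent by blast
    then show ?thesis
      using \<open>\<iota> (commutator M N) + bracket L t1 (\<iota> N) = 0\<close> \<iota>_inj[of "commutator M N" 0] by simp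
  qed
  have "M = 0"
  proof (rule sl2_center[OF two M])
    show "commutator N M = 0" if "N \<in> sl2" for N
      using *[OF that] by (simp add: commutator_def)
  qed
  then have "t = t1" using t_eq by simp
  then show "t \<in> {t \<in> part L 1. (\<forall>N\<in>sl2. bracket L (\<iota> N) t = 0) \<and> (\<forall>v\<in>part L 1. bracket L t v = 0)}"
    using t1 * c bracket_odd_even by (auto simp: odd_carr)
next
  fix t
  assume "t \<in> {t \<in> part L 1. (\<forall>N\<in>sl2. bracket L (\<iota> N) t = 0) \<and> (\<forall>v\<in>part L 1. bracket L t v = 0)}"
  then have t: "t \<in> part L 1" "\<And>N. N \<in> sl2 \<Longrightarrow> bracket L (\<iota> N) t = 0"
    "\<And>v. v \<in> part L 1 \<Longrightarrow> bracket L t v = 0"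
    by auto
  have "bracket L t y = 0" if "y \<in> carr L" for y
  proof -
    obtain N v where "N \<in> sl2" "v \<in> part L 1" "y = \<iota> N + v"
      using carr_cases[OF \<open>y \<in> carr L\<close>] .
    then show ?thesis
      using t by (simp add: bracket_add_right even_carr odd_carr bracket_odd_even)
  qed
  then show "t \<in> center L" using t by (simp add: center_def odd_carr)
qed

lemma center_radical:
  assumes "sl2_odd_module (smul L) act P"
    and \<pi>: "\<And>v. \<pi> v \<in> part L 1" and \<pi>_id: "\<And>v. v \<in> part L 1 \<Longrightarrow> \<pi> v = v"
    and act: "\<And>A v. A \<in> sl2 \<Longrightarrow> act A v = bracket L (\<iota> A) (\<pi> v)"
    and P: "\<And>v w. \<iota> (P v w) = bracket L (\<pi> v) (\<pi> w)"
  shows "z \<in> center L \<longleftrightarrow> z \<in> part L 1 \<and> z \<in> sl2_odd_module.radical act P"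
proof -
  interpret M: sl2_odd_module "smul L" act P by fact
  have "P z v = 0 \<longleftrightarrow> bracket L (\<pi> z) (\<pi> v) = 0" for v
    using P[of z v] \<iota>_inj[OF M.P_sl2 sl2_zero, of z v] by simp
  moreover have "(\<forall>v. bracket L z (\<pi> v) = 0) \<longleftrightarrow> (\<forall>v\<in>part L 1. bracket L z v = 0)"
    using \<pi> \<pi>_id by metis
  ultimately show ?thesis
    by (auto simp: center_eq M.radical_def M.invariants_def act \<pi>_id)
qed

end


section \<open>The classification\<close>

context sl2_superalgebra
begin

lemma zero_center: "0 \<in> center L"
proof -
  have "0 \<in> carr L" using zero_part part_carr by blast
  then show ?thesis using bracket_smult_left[of 0 _ 0] by (simp add: center_def)
qed

text \<open>The vectors \<psi> v and r come from the module on the whole type and need not be odd.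
  Composing with \<pi> moves them into the odd part without changing P or the action.\<close>

lemma adjoint_trivial_center_case:
  assumes x: "x \<in> part L 1" and M: "M \<in> sl2" "\<iota> M = bracket L x x" "det M \<noteq> 0"
  shows "\<exists>\<Phi>. adjoint_trivial_center_decomposition \<iota> L \<Phi>"
proof -
  obtain \<pi> act P where module: "sl2_odd_module (smul L) act P"
    and \<pi>: "\<And>v. \<pi> v \<in> part L 1" and \<pi>_id: "\<And>v. v \<in> part L 1 \<Longrightarrow> \<pi> v = v"
    and \<pi>_add: "\<And>v w. \<pi> (v + w) = \<pi> v + \<pi> w" and \<pi>_scale: "\<And>c v. \<pi> (smul L c v) = smul L c (\<pi> v)"
    and act_odd: "\<And>A v. act A v \<in> part L 1"
    and act: "\<And>A v. A \<in> sl2 \<Longrightarrow> act A v = bracket L (\<iota> A) (\<pi> v)"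
    and P: "\<And>v w. \<iota> (P v w) = bracket L (\<pi> v) (\<pi> w)"
    by (rule module_structure) (rule that)
  interpret M: sl2_odd_module "smul L" act P by (rule module)
  note center_iff = center_radical[OF module \<pi> \<pi>_id act P]
  have "P x x = M"
    using M P[of x x] \<iota>_inj[OF M.P_sl2 M(1)] by (simp add: \<pi>_id x)
  then have "det (P x x) \<noteq> 0" using M by simp
  then obtain \<psi> r where \<psi>_add: "\<And>M N. M \<in> sl2 \<Longrightarrow> N \<in> sl2 \<Longrightarrow> \<psi> (M + N) = \<psi> M + \<psi> N"
    and \<psi>_scale: "\<And>c M. M \<in> sl2 \<Longrightarrow> \<psi> (mat_smult c M) = smul L c (\<psi> M)"
    and \<psi>_act: "\<And>M N. M \<in> sl2 \<Longrightarrow> N \<in> sl2 \<Longrightarrow> act N (\<psi> M) = \<psi> (commutator N M)"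
    and P_\<psi>: "\<And>M N. M \<in> sl2 \<Longrightarrow> N \<in> sl2 \<Longrightarrow> P (\<psi> M) (\<psi> N) = 0"
    and r: "r \<in> M.invariants"
    and P_\<psi>_r: "\<And>M. M \<in> sl2 \<Longrightarrow> P (\<psi> M) r = M"
    and dec: "\<And>v. \<exists>M\<in>sl2. \<exists>s. \<exists>t\<in>M.radical. v = \<psi> M + smul L s r + t"
    by (rule M.semisimple_case) (rule that)
  have radical: "act N z = 0" "P z v = 0" "P v z = 0" "\<pi> z = z" "z \<in> part L 1"
    if "z \<in> center L" "N \<in> sl2" for z N v
    using that M.P_sym[of v z] by (auto simp: center_iff M.radical_def M.invariants_def \<pi>_id)
  have P_r_\<psi>: "P r (\<psi> M) = M" if "M \<in> sl2" for M
    using P_\<psi>_r[OF that] by (simp add: M.P_sym)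
  have P_rr: "P r r = 0" by (rule M.P_invariants[OF r r])
  define Q where "Q p = (case p of (v, s, z) \<Rightarrow> \<psi> v + smul L s r + z)"
    for p :: "('k ^ 2 ^ 2) \<times> 'k \<times> 'g"
  define \<Phi> where "\<Phi> p = \<pi> (Q p)" for p
  define D where "D = (sl2 :: ('k ^ 2 ^ 2) set) \<times> (UNIV :: 'k set) \<times> center L"
  have P_\<pi>: "P (\<pi> u) w = P u w" "P u (\<pi> w) = P u w" for u w
    using \<iota>_inj[OF M.P_sl2 M.P_sl2] P by (metis \<pi> \<pi>_id)+
  have PQ: "P (Q (v, s, z)) (Q (w, s', y)) = mat_smult s' v + mat_smult s w"
    if "v \<in> sl2" "z \<in> center L" "w \<in> sl2" "y \<in> center L" for v s z w s' y
    using that radical[OF \<open>z \<in> center L\<close> sl2_zero] radical[OF \<open>y \<in> center L\<close> sl2_zero]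
    by (simp add: Q_def M.P_simps P_\<psi> P_r_\<psi> P_\<psi>_r P_rr mat2_eq_iff algebra_simps)
  have "bij_betw \<Phi> D (part L 1)"
  proof (rule bij_betwI')
    fix p q assume "p \<in> D" "q \<in> D"
    then obtain v s z w s' y where p: "p = (v, s, z)" "v \<in> sl2" "z \<in> center L"
      and q: "q = (w, s', y)" "w \<in> sl2" "y \<in> center L"
      by (auto simp: D_def)
    show "\<Phi> p = \<Phi> q \<longleftrightarrow> p = q"
    proof
      assume eq: "\<Phi> p = \<Phi> q"
      \<comment> \<open>The components are read off through P: pairing with
        \<open>Q (0, 1, 0)\<close> returns the matrix v, and pairing with a nonzero traceless matrix
        returns the scalar s.\<close>
      then have PQ_eq: "P (Q p) u = P (Q q) u" for u by (metis P_\<pi>(1) \<Phi>_def)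
      have "v = w"
        using PQ_eq[of "Q (0, 1, 0)"] by (simp add: p q PQ zero_center)
      have "mat2 1 0 0 (-1) \<in> (sl2 :: ('k ^ 2 ^ 2) set)" by (simp add: mem_sl2_iff)
      then have "mat_smult s (mat2 1 0 0 (-1)) = mat_smult s' (mat2 1 0 0 (-1))"
        using PQ_eq[of "Q (mat2 1 0 0 (-1), 0, 0)"] by (simp add: p q PQ zero_center)
      then have "s = s'" by (simp add: mat2_eq_iff)
      then show "p = q"
        using eq \<open>v = w\<close> radical[OF p(3) sl2_zero] radical[OF q(3) sl2_zero]
        by (simp add: p q \<Phi>_def Q_def \<pi>_add)
    qed simp
  next
    show "\<Phi> p \<in> part L 1" if "p \<in> D" for p by (simp add: \<Phi>_def \<pi>)
  next
    fix u assume u: "u \<in> part L 1"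
    obtain M s t where "M \<in> sl2" "t \<in> M.radical" and eq: "u = \<psi> M + smul L s r + t"
      using dec by blast
    have "\<pi> t \<in> center L"
      using \<open>t \<in> M.radical\<close> by (auto simp: center_iff M.radical_def M.invariants_def \<pi> P_\<pi> act \<pi>_id)
    moreover have "u = \<Phi> (M, s, \<pi> t)"
      using \<pi>_id[OF u] by (simp add: \<Phi>_def Q_def eq \<pi>_add \<pi>_id \<pi>)
    ultimately show "\<exists>p\<in>D. u = \<Phi> p" using \<open>M \<in> sl2\<close> by (force simp: D_def)
  qed
  moreover have "\<forall>p\<in>D. \<forall>q\<in>D. \<Phi> (p + q) = \<Phi> p + \<Phi> q"
    by (auto simp: D_def \<Phi>_def Q_def \<psi>_add \<pi>_add scale_left_distrib algebra_simps)
  moreover have "\<forall>c. \<forall>(v, s, z)\<in>D. \<Phi> (mat_smult c v, c * s, smul L c z) = smul L c (\<Phi> (v, s, z))"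
    by (auto simp: D_def \<Phi>_def Q_def \<psi>_scale \<pi>_add \<pi>_scale scale_right_distrib)
  moreover have "\<forall>z\<in>center L. \<Phi> (0, 0, z) = z"
    using \<psi>_scale[of 0 0] by (auto simp: \<Phi>_def Q_def radical[OF _ sl2_zero])
  moreover have "\<forall>A\<in>sl2. \<forall>(v, s, z)\<in>D.
      bracket L (\<iota> A) (\<Phi> (v, s, z)) = \<Phi> (commutator A v, 0, bracket L (\<iota> A) z)"
  proof clarify
    fix A v s z assume A: "A \<in> (sl2 :: ('k ^ 2 ^ 2) set)" and "(v, s, z) \<in> D"
    then have v: "v \<in> sl2" and z: "z \<in> center L" by (auto simp: D_def)
    have "bracket L (\<iota> A) (\<Phi> (v, s, z)) = act A (Q (v, s, z))" by (simp add: act[OF A] \<Phi>_def)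
    also have "\<dots> = \<psi> (commutator A v)"
      using r A by (simp add: Q_def M.act_simps \<psi>_act[OF v A] radical[OF z A] M.invariants_def)
    also have "\<dots> = \<pi> (\<psi> (commutator A v))"
      using \<pi>_id[OF act_odd[of A "\<psi> v"]] by (simp add: \<psi>_act[OF v A])
    also have "bracket L (\<iota> A) z = 0"
      using act[OF A, of z] by (simp add: radical[OF z A])
    then have "\<pi> (\<psi> (commutator A v)) = \<Phi> (commutator A v, 0, bracket L (\<iota> A) z)"
      by (simp add: \<Phi>_def Q_def)
    finally show "bracket L (\<iota> A) (\<Phi> (v, s, z)) = \<Phi> (commutator A v, 0, bracket L (\<iota> A) z)" .
  qed
  moreover have "\<forall>(v, s, z)\<in>D. \<forall>(w, s', y)\<in>D.
      bracket L (\<Phi> (v, s, z)) (\<Phi> (w, s', y)) = \<iota> (mat_smult s' v + mat_smult s w)"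
    by (auto simp: D_def \<Phi>_def P[symmetric] PQ)
  ultimately show ?thesis
    unfolding adjoint_trivial_center_decomposition_def Let_def D_def[symmetric] by blast
qed

section \<open>The orthosymplectic case\<close>

lemma osp_sum_parts:
  "carr (direct_sum osp12 (sub_superalgebra L (center L))) = (sl2 \<times> UNIV) \<times> center L"
  "part (direct_sum osp12 (sub_superalgebra L (center L))) 0 = (sl2 \<times> {0}) \<times> {0}"
  "part (direct_sum osp12 (sub_superalgebra L (center L))) 1 = ({0} \<times> UNIV) \<times> center L"
proof -
  \<comment> \<open>The centre is purely odd, so the even part of the sum comes from
    \<open>osp12\<close> alone.\<close>
  have odd: "center L \<subseteq> part L 1" by (auto simp: center_eq)
  have even: "part L 0 \<inter> center L = {0}"
    using odd zero_center parts_independent zero_part by blast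
  show 0: "part (direct_sum osp12 (sub_superalgebra L (center L))) 0 = (sl2 \<times> {0}) \<times> {0}"
    by (simp add: direct_sum_def osp12_def sub_superalgebra_def even)
  show 1: "part (direct_sum osp12 (sub_superalgebra L (center L))) 1 = ({0} \<times> UNIV) \<times> center L"
    using odd by (simp add: direct_sum_def osp12_def sub_superalgebra_def Int_absorb1)
  show "carr (direct_sum osp12 (sub_superalgebra L (center L))) = (sl2 \<times> UNIV) \<times> center L"
    unfolding carr_def 0 1 by force
qed

lemma parts_unique:
  assumes "x \<in> part L 0" "x' \<in> part L 0" "y \<in> part L 1" "y' \<in> part L 1" and eq: "x + y = x' + y'"
  shows "x = x'" "y = y'"
proof -
  have "x - x' = y' - y" using eq by (simp add: algebra_simps)
  then have "x - x' \<in> part L 0 \<inter> part L 1"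
    using assms subspace_diff[OF subspace_part] by (metis IntI)
  then show "x = x'" using parts_independent by simp
  then show "y = y'" using eq by simp
qed

lemma sum_carr: "x \<in> part L 0 \<Longrightarrow> y \<in> part L 1 \<Longrightarrow> x + y \<in> carr L"
  by (auto simp: carr_def)

lemma bracket_sum:
  assumes "x \<in> part L 0" "x' \<in> part L 0" "y \<in> part L 1" "y' \<in> part L 1"
  shows "bracket L (x + y) (x' + y')
    = bracket L x x' + bracket L y y' + (bracket L x y' - bracket L x' y)"
proof -
  have "x \<in> carr L" "x' \<in> carr L" "y \<in> carr L" "y' \<in> carr L" "x' + y' \<in> carr L"
    using assms sum_carr[of x' y'] by (auto simp: even_carr odd_carr)
  then show ?thesis
    using assms by (simp add: bracket_add_left bracket_add_right bracket_odd_even)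
qed

text \<open>The isomorphism sends ((A, v), z) to \<iota> A + \<pi> (G v + z), where G embeds the
  standard representation.\<close>

lemma osp_case:
  assumes x: "x \<in> part L 1" "bracket L x x = \<iota> (mat2 0 2 0 0)"
    and nil: "\<And>v M. v \<in> part L 1 \<Longrightarrow> M \<in> sl2 \<Longrightarrow> \<iota> M = bracket L v v \<Longrightarrow> det M = 0"
  shows "superalgebra_isomorphic L (direct_sum osp12 (sub_superalgebra L (center L)))"
proof -
  obtain \<pi> act P where module: "sl2_odd_module (smul L) act P"
    and \<pi>: "\<And>v. \<pi> v \<in> part L 1" and \<pi>_id: "\<And>v. v \<in> part L 1 \<Longrightarrow> \<pi> v = v"
    and \<pi>_add: "\<And>v w. \<pi> (v + w) = \<pi> v + \<pi> w" and \<pi>_scale: "\<And>c v. \<pi> (smul L c v) = smul L c (\<pi> v)"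
    and act_odd: "\<And>A v. act A v \<in> part L 1"
    and act: "\<And>A v. A \<in> sl2 \<Longrightarrow> act A v = bracket L (\<iota> A) (\<pi> v)"
    and P: "\<And>v w. \<iota> (P v w) = bracket L (\<pi> v) (\<pi> w)"
    by (rule module_structure) (rule that)
  interpret M: sl2_odd_module "smul L" act P by (rule module)
  note center_iff = center_radical[OF module \<pi> \<pi>_id act P]
  have "mat2 0 2 0 0 \<in> (sl2 :: ('k ^ 2 ^ 2) set)" by (simp add: mem_sl2_iff)
  then have P_xx: "P x x = mat2 0 2 0 0"
    using x P[of x x] \<iota>_inj[OF M.P_sl2] by (simp add: \<pi>_id)
  have nil': "det (P v v) = 0" for v
    by (rule nil[OF \<pi>[of v] M.P_sl2 P])
  obtain G where G_add: "\<And>v w. G (v + w) = G v + G w"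
    and G_scale: "\<And>c v. G (c *s v) = smul L c (G v)"
    and G_act: "\<And>M v. M \<in> sl2 \<Longrightarrow> act M (G v) = G (M *v v)"
    and G_P: "\<And>v w. P (G v) (G w) = osp_odd_bracket v w"
    and dec: "\<And>u. \<exists>v. \<exists>t\<in>M.radical. u = G v + t"
    by (rule M.nilpotent_square_decomposition[OF nil' P_xx]) (rule that)
  have P_\<pi>: "P (\<pi> u) w = P u w" "P u (\<pi> w) = P u w" for u w
    using \<iota>_inj[OF M.P_sl2 M.P_sl2] P by (metis \<pi> \<pi>_id)+
  have radical: "act N z = 0" "P z v = 0" "P v z = 0" "\<pi> z = z" "z \<in> part L 1"
    if "z \<in> center L" "N \<in> sl2" for z N v
    using that M.P_sym[of v z] by (auto simp: center_iff M.radical_def M.invariants_def \<pi>_id)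
  let ?S = "direct_sum osp12 (sub_superalgebra L (center L))"
  define f where "f p = (case p of ((A, v), z) \<Rightarrow> \<iota> A + \<pi> (G v + z))"
    for p :: "(('k ^ 2 ^ 2) \<times> ('k ^ 2)) \<times> 'g"
  have G0: "G 0 = 0" using G_scale[of 0 0] by simp
  have \<pi>0: "\<pi> 0 = 0" using \<pi>_scale[of 0 0] by simp
  have smul_S: "smul ?S c ((A, v), z) = ((mat_smult c A, c *s v), smul L c z)"
    and bracket_S: "bracket ?S ((A, v), z) ((B, w), y)
        = ((commutator A B + osp_odd_bracket v w, A *v w - B *v v), bracket L z y)"
    for c A v z B w y
    by (simp_all add: direct_sum_def osp12_def sub_superalgebra_def)
  have center_bracket: "bracket L z y = 0" if "z \<in> center L" "y \<in> center L" for z y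
    using that by (simp add: center_def)
  have center_add: "z + y \<in> center L" and center_scale: "smul L c z \<in> center L"
    if "z \<in> center L" "y \<in> center L" for z y c
    using that
    by (auto simp: center_iff M.radical_def M.P_simps M.invariants_add M.invariants_scale part_add part_smul)
  have osp_sl2: "osp_odd_bracket v w \<in> sl2" for v w :: "'k ^ 2"
    using M.P_sl2 by (simp add: G_P[symmetric])
  have surj_odd: "\<exists>v. \<exists>z\<in>center L. u = \<pi> (G v + z)" if u: "u \<in> part L 1" for u
  proof -
    obtain v t where t: "t \<in> M.radical" and eq: "u = G v + t" using dec by blast
    have "\<pi> t \<in> center L"
      using t by (auto simp: center_iff M.radical_def M.invariants_def \<pi> P_\<pi> act \<pi>_id)
    moreover have "u = \<pi> (G v + \<pi> t)"
      using \<pi>_id[OF u] by (simp add: eq \<pi>_add \<pi>_id \<pi>)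
    ultimately show ?thesis by blast
  qed
  have "superalgebra_iso f ?S L"
    unfolding superalgebra_iso_def
  proof (intro conjI allI ballI)
    show "bij_betw f (carr ?S) (carr L)"
    proof (rule bij_betwI')
      fix p q assume "p \<in> carr ?S" "q \<in> carr ?S"
      then obtain A v z B w y where p: "p = ((A, v), z)" "A \<in> sl2" "z \<in> center L"
        and q: "q = ((B, w), y)" "B \<in> sl2" "y \<in> center L"
        by (auto simp: osp_sum_parts)
      show "f p = f q \<longleftrightarrow> p = q"
      proof
        assume "f p = f q"
        then have "\<iota> A + \<pi> (G v + z) = \<iota> B + \<pi> (G w + y)" by (simp add: f_def p q)
        note * = parts_unique[OF \<iota>_even[OF p(2)] \<iota>_even[OF q(2)] \<pi> \<pi> this]
        have "A = B" using *(1) p q by (simp add: \<iota>_inj)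
        have "P (G v + z) u = P (G w + y) u" for u using *(2) by (metis P_\<pi>(1))
        then have "osp_odd_bracket v u = osp_odd_bracket w u" for u
          by (simp add: G_P[symmetric] M.P_add_left radical[OF p(3) sl2_zero] radical[OF q(3) sl2_zero])
        \<comment> \<open>The bracket of (a, b) with (1, 0) has entries 2 a and b in its second
          column, so it determines the vector.\<close>
        from this[of "vector [1, 0]"] have "v = w"
          using two by (simp add: osp_odd_bracket_def Let_def mat2_def[symmetric] mat2_eq_iff
              vec_eq_iff[of v] forall_2 vector_2)
        then show "p = q"
          using *(2) \<open>A = B\<close> radical[OF p(3) sl2_zero] radical[OF q(3) sl2_zero]
          by (simp add: p q \<pi>_add)
      qed simp
    next
      show "f p \<in> carr L" if "p \<in> carr ?S" for p
        using that \<pi> by (auto simp: osp_sum_parts f_def intro!: sum_carr)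
    next
      fix u assume "u \<in> carr L"
      then obtain A u1 where "A \<in> sl2" "u1 \<in> part L 1" "u = \<iota> A + u1" by (rule carr_cases)
      then show "\<exists>p\<in>carr ?S. u = f p"
        using surj_odd[of u1] by (force simp: osp_sum_parts f_def)
    qed
    show "f ` part ?S \<alpha> = part L \<alpha>" for \<alpha>
    proof (cases "\<alpha> = 0")
      case True
      have "f ` part ?S 0 = \<iota> ` sl2" by (force simp: osp_sum_parts f_def G0 \<pi>0)
      then show ?thesis using \<iota>_bij True by (simp add: bij_betw_def)
    next
      case False
      then have "\<alpha> = 1" by simp
      have "f ` part ?S 1 = part L 1"
        using surj_odd \<pi> by (force simp: osp_sum_parts f_def)
      then show ?thesis using \<open>\<alpha> = 1\<close> by simp
    qed
    show "f (p + q) = f p + f q" if "p \<in> carr ?S" "q \<in> carr ?S" for p q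
      using that by (auto simp: osp_sum_parts f_def G_add \<pi>_add \<iota>_add algebra_simps)
    show "f (smul ?S c p) = smul L c (f p)" if "p \<in> carr ?S" for c p
      using that by (auto simp: osp_sum_parts f_def smul_S G_scale \<pi>_add \<pi>_scale \<iota>_smult scale_right_distrib)
    show "f (bracket ?S p q) = bracket L (f p) (f q)" if pq: "p \<in> carr ?S" "q \<in> carr ?S" for p q
    proof -
      obtain A v z B w y where p: "p = ((A, v), z)" "A \<in> sl2" "z \<in> center L"
        and q: "q = ((B, w), y)" "B \<in> sl2" "y \<in> center L"
        using pq by (auto simp: osp_sum_parts)
      have \<pi>_act: "\<pi> (G (N *v u)) = act N (G u)" if "N \<in> sl2" for N u
        using \<pi>_id[OF act_odd] by (simp add: G_act[OF that, symmetric])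
      \<comment> \<open>Adding B v back reduces the odd component to additivity of G and
        \<pi>.\<close>
      have "act A (G w) = \<pi> (G ((A *v w - B *v v) + B *v v))" by (simp add: \<pi>_act p)
      also have "\<dots> = \<pi> (G (A *v w - B *v v)) + act B (G v)"
        by (simp only: G_add \<pi>_add \<pi>_act[OF q(2)])
      finally have "f (bracket ?S p q) = \<iota> (commutator A B) + \<iota> (osp_odd_bracket v w)
          + (act A (G w) - act B (G v))"
        by (simp add: p q bracket_S f_def center_bracket \<iota>_add osp_sl2 eq_diff_eq)
      also have "\<dots> = bracket L (\<iota> A) (\<iota> B) + \<iota> (P (G v + z) (G w + y))
          + (act A (G w + y) - act B (G v + z))"
        using p q radical[OF p(3)] radical[OF q(3)]
        by (simp add: \<iota>_commutator M.P_simps M.act_simps G_P)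
      also have "\<dots> = bracket L (f p) (f q)"
        using bracket_sum[OF \<iota>_even[OF p(2)] \<iota>_even[OF q(2)] \<pi>[of "G v + z"] \<pi>[of "G w + y"]]
        by (simp add: P act p q f_def)
      finally show ?thesis .
    qed
  qed
  then have "superalgebra_iso (inv_into (carr ?S) f) L ?S"
  proof (rule superalgebra_iso_inv_into)
    show "part ?S \<alpha> \<subseteq> carr ?S" for \<alpha>
      using bit_exhaust[of \<alpha>] zero_center by (auto simp: osp_sum_parts)
    show "p + q \<in> carr ?S" if "p \<in> carr ?S" "q \<in> carr ?S" for p q
      using that by (auto simp: osp_sum_parts center_add)
    show "smul ?S c p \<in> carr ?S" if "p \<in> carr ?S" for c p
      using that by (auto simp: osp_sum_parts smul_S center_scale)
    show "bracket ?S p q \<in> carr ?S" if "p \<in> carr ?S" "q \<in> carr ?S" for p q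
      using that by (auto simp: osp_sum_parts bracket_S center_bracket zero_center osp_sl2)
  qed
  then show ?thesis unfolding superalgebra_isomorphic_def by blast
qed

text \<open>Conjugation by g is an automorphism of sl(2). Changing \<iota> by it brings a nilpotent
  square into normal form while L stays the same.\<close>

lemma conjugate:
  assumes g: "g ** g' = mat 1" "g' ** g = mat 1"
  shows "sl2_superalgebra L (\<lambda>M. \<iota> (g ** M ** g'))"
proof unfold_locales
  have tr: "g ** M ** g' \<in> sl2 \<longleftrightarrow> M \<in> sl2" "g' ** M ** g \<in> sl2 \<longleftrightarrow> M \<in> sl2" for M
    using trace_mul_sym[of "g ** M" g'] trace_mul_sym[of "g' ** M" g] g
    by (simp_all add: sl2_def matrix_mul_assoc)
  have inv: "g' ** (g ** M ** g') ** g = M" "g ** (g' ** M ** g) ** g' = M" for M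
    by (metis g matrix_mul_assoc matrix_mul_lid matrix_mul_rid)+
  have "bij_betw (\<lambda>M. g ** M ** g') sl2 sl2"
    by (rule bij_betw_byWitness[of _ "\<lambda>M. g' ** M ** g"]) (auto simp: inv tr)
  then have bij: "bij_betw (\<lambda>M. \<iota> (g ** M ** g')) sl2 (part L 0)"
    using bij_betw_trans[OF _ \<iota>_bij] by (auto simp: comp_def)
  have add: "g ** (A + B) ** g' = g ** A ** g' + g ** B ** g'" for A B
    by (simp add: mat2_eq_iff matrix_mult_nth2 algebra_simps)
  have smult: "g ** mat_smult c A ** g' = mat_smult c (g ** A ** g')" for c A
    by (simp add: mat2_eq_iff matrix_mult_nth2 algebra_simps)
  have comm: "g ** commutator A B ** g' = commutator (g ** A ** g') (g ** B ** g')" for A B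
  proof -
    have "(g ** A ** g') ** (g ** B ** g') = g ** (A ** B) ** g'" for A B
      by (metis g matrix_mul_assoc matrix_mul_lid matrix_mul_rid)
    moreover have "g ** (A - B) ** g' = g ** A ** g' - g ** B ** g'" for A B
      by (simp add: mat2_eq_iff matrix_mult_nth2 algebra_simps)
    ultimately show ?thesis by (simp add: commutator_def)
  qed
  show "even_part_sl2 (\<lambda>M. \<iota> (g ** M ** g')) L"
    unfolding even_part_sl2_def superalgebra_iso_def carr_sl2_algebra carr_even
    using bij parts_independent
    by (simp add: sl2_algebra_def sub_superalgebra_def add smult comm \<iota>_add \<iota>_smult \<iota>_commutator tr
        bij_betw_def Int_commute)
qed (fact two three)+

end

section \<open>The case distinction on odd squares\<close>

theorem theorem6p1:
  fixes L :: "('k::field, 'g::ab_group_add) superalgebra"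
    and \<iota> :: "'k ^ 2 ^ 2 \<Rightarrow> 'g"
  assumes field: "CHAR('k) = 0 \<or>
      (algebraically_closed TYPE('k) \<and> CHAR('k) > 0 \<and> CHAR('k) \<noteq> 2 \<and> CHAR('k) \<noteq> 3)"
    and "lie_superalgebra L"
    and "finite_dim L"
    and "even_part_sl2 \<iota> L"
  shows "(\<forall>x\<in>part L 1. \<forall>y\<in>part L 1. bracket L x y = 0)
    \<or> (\<exists>\<Phi>. adjoint_trivial_center_decomposition \<iota> L \<Phi>)
    \<or> superalgebra_isomorphic L (direct_sum osp12 (sub_superalgebra L (center L)))"
proof -
  \<comment> \<open>The characteristic divides a prime only if it equals it, since it is never
    1.\<close>
  have prime_nonzero: "(of_nat p :: 'k) \<noteq> 0" if "prime p" "CHAR('k) \<noteq> p" for p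
    using that prime_nat_iff[of p] by (auto simp: of_nat_eq_0_iff_char_dvd)
  have "prime (2::nat)" "prime (3::nat)" by simp_all
  then have "(of_nat 2 :: 'k) \<noteq> 0" "(of_nat 3 :: 'k) \<noteq> 0"
    using field by (intro prime_nonzero; auto)+
  then have two: "(2::'k) \<noteq> 0" and three: "(3::'k) \<noteq> 0" by simp_all
  interpret lie_superalgebra L by fact
  interpret sl2_superalgebra L \<iota> by unfold_locales (fact assms two three)+
  consider "\<forall>x\<in>part L 1. bracket L x x = 0"
    | x M where "x \<in> part L 1" "M \<in> sl2" "\<iota> M = bracket L x x" "det M \<noteq> 0"
    | x where "x \<in> part L 1" "bracket L x x \<noteq> 0"
        "\<And>v M. v \<in> part L 1 \<Longrightarrow> M \<in> sl2 \<Longrightarrow> \<iota> M = bracket L v v \<Longrightarrow> det M = 0"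
    by metis
  then show ?thesis
  proof cases
    case 1
    have "bracket L x y = 0" if x: "x \<in> part L 1" and y: "y \<in> part L 1" for x y
    proof -
      have "0 = bracket L (x + y) (x + y)" using 1 part_add[OF x y] by simp
      also have "\<dots> = bracket L x y + bracket L x y"
        using bspec[OF 1 x] bspec[OF 1 y] x y bracket_odd_sym[OF y x]
        by (simp add: bracket_add_left bracket_add_right odd_carr part_add)
      also have "\<dots> = smul L 2 (bracket L x y)"
        using scale_left_distrib[of 1 1 "bracket L x y"] by simp
      finally show ?thesis using two by simp
    qed
    then show ?thesis by blast
  next
    case 2
    then show ?thesis using adjoint_trivial_center_case by blast
  next
    case 3
    obtain A where A: "A \<in> sl2" "\<iota> A = bracket L x x"
      using even_eq_\<iota>[OF bracket_odd_odd[OF 3(1) 3(1)]] by metis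
    have "A \<noteq> 0" using A 3(2) by auto
    then obtain g g' where g: "g ** g' = mat 1" "g' ** g = mat 1" and A_eq: "A = g ** mat2 0 2 0 0 ** g'"
      using nilpotent_conjugate[OF two A(1) 3(3)[OF 3(1) A]] by blast
    \<comment> \<open>With the conjugated identification the square of x becomes 2 E. The conclusion
      of \<open>osp_case\<close> does not mention the identification, so it applies to the original
      L.\<close>
    interpret C: sl2_superalgebra L "\<lambda>M. \<iota> (g ** M ** g')"
      by (rule conjugate[OF g])
    have "det M = 0" if "v \<in> part L 1" "M \<in> sl2" "\<iota> (g ** M ** g') = bracket L v v" for v M
    proof -
      have "g ** M ** g' \<in> sl2"
        using trace_mul_sym[of "g ** M" g'] g that(2) by (simp add: sl2_def matrix_mul_assoc)
      then have "det (g ** M ** g') = 0" using 3(3)[OF that(1) _ that(3)] by blast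
      moreover have "det g * det g' = 1" using g(1) by (metis det_mul det_I)
      ultimately show ?thesis by (auto simp: det_mul)
    qed
    then show ?thesis using C.osp_case[OF 3(1)] A(2) A_eq by simp
  qed
qed

end
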